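(* Every function $f\in\mathcal{T}_H^O$ is univalent in each of the following domains: (a) the disk $D(0;\sqrt6-\sqrt5)$; (b) the set $\left\{z\in\mathbb{D}:\left|\dfrac{2z}{1+z^2}\right|<\sqrt2-1\right\}$.
   Context: $\mathbb{D}=\{z\in\mathbb{C}:|z|<1\}$, and $D(z_0;r)$ is the open disk with center $z_0\in\mathbb{C}$ and radius $r>0$. A (complex-valued) harmonic function $f$ on $\mathbb{D}$ can be written $f=h+\overline{g}$ with $h,g$ analytic on $\mathbb{D}$; let $\omega$ be the meromorphic function given by $g'=\omega h'$ (removable singularities removed). $f$ is sense-preserving at $z_0\in\mathbb{D}$ if $h'\not\equiv 0$ in some neighborhood of $z_0$ and $\omega$ is analytic at $z_0$ with $|\omega(z_0)|<1$ (so $h'(z_0)=0$ is allowed); $f$ is sense-preserving in $\mathbb{D}$ if it is so at every point of $\mathbb{D}$. The class $\mathcal{T}_H$ consists of all sense-preserving harmonic functions $f=h+\overline{g}$ on $\mathbb{D}$ such that $f(z)$ is real if and only if $z$ is real, $f(0)=0$, $|h'(0)|=1$, and $f(r)>0$ for $0<r<1$. $\mathcal{T}_H^O$ is the subclass of those $f\in\mathcal{T}_H$ with $g'(0)=0$. Univalent means injective. *)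

theory Defs
  imports "HOL-Complex_Analysis.Complex_Analysis"
begin

text \<open>
  Complex-valued harmonic functions on an open set: the partial derivatives up to order two
  with respect to the real coordinates exist, those of second order are continuous, and the
  Laplacian vanishes.
\<close>

definition harmonic_on :: "(complex \<Rightarrow> complex) \<Rightarrow> complex set \<Rightarrow> bool"
    (infixl "(harmonic'_on)" 50) where
  "f harmonic_on S \<longleftrightarrow> open S \<and>
     (\<exists>fx fy fxx fxy fyx fyy.
        (\<forall>z\<in>S. (f has_derivative (\<lambda>w. Re w *\<^sub>R fx z + Im w *\<^sub>R fy z)) (at z) \<and>
               (fx has_derivative (\<lambda>w. Re w *\<^sub>R fxx z + Im w *\<^sub>R fxy z)) (at z) \<and>
               (fy has_derivative (\<lambda>w. Re w *\<^sub>R fyx z + Im w *\<^sub>R fyy z)) (at z) \<and>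
               fxx z + fyy z = 0) \<and>
        continuous_on S fxx \<and> continuous_on S fxy \<and>
        continuous_on S fyx \<and> continuous_on S fyy)"

definition canonical_repr ::
  "complex set \<Rightarrow> (complex \<Rightarrow> complex) \<Rightarrow> (complex \<Rightarrow> complex) \<Rightarrow> (complex \<Rightarrow> complex) \<Rightarrow> bool" where
  "canonical_repr S f h g \<longleftrightarrow>
     h holomorphic_on S \<and> g holomorphic_on S \<and> (\<forall>z\<in>S. f z = h z + cnj (g z))"

text \<open>
  The second complex dilatation, with removable singularities removed.  At a pole
  \<^const>\<open>remove_sings\<close> returns a junk value, but the function is not analytic there.
\<close>

definition dilatation :: "(complex \<Rightarrow> complex) \<Rightarrow> (complex \<Rightarrow> complex) \<Rightarrow> complex \<Rightarrow> complex" where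
  "dilatation h g = remove_sings (\<lambda>z. deriv g z / deriv h z)"

text \<open>
  The derivative of \<open>h\<close> may vanish at \<open>z\<close> itself, but not identically near \<open>z\<close>.
\<close>

definition sense_preserving_at ::
  "(complex \<Rightarrow> complex) \<Rightarrow> (complex \<Rightarrow> complex) \<Rightarrow> complex \<Rightarrow> bool" where
  "sense_preserving_at h g z \<longleftrightarrow>
     \<not> (\<forall>\<^sub>F w in nhds z. deriv h w = 0) \<and>
     dilatation h g analytic_on {z} \<and> norm (dilatation h g z) < 1"

text \<open>
  The functions \<open>h\<close> and \<open>g\<close> are unique only up to additive constants, but all conditions on
  them below involve their derivatives only.  Realness of \<open>f r\<close> for \<open>0 < r < 1\<close> is part of
  the condition that \<open>f\<close> is real exactly on the real axis.
\<close>

definition T_H_repr ::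
  "(complex \<Rightarrow> complex) \<Rightarrow> (complex \<Rightarrow> complex) \<Rightarrow> (complex \<Rightarrow> complex) \<Rightarrow> bool" where
  "T_H_repr f h g \<longleftrightarrow>
     f harmonic_on ball 0 1 \<and> canonical_repr (ball 0 1) f h g \<and>
     (\<forall>z\<in>ball 0 1. sense_preserving_at h g z) \<and>
     (\<forall>z\<in>ball 0 1. f z \<in> \<real> \<longleftrightarrow> z \<in> \<real>) \<and>
     f 0 = 0 \<and> norm (deriv h 0) = 1 \<and>
     (\<forall>r::real. 0 < r \<and> r < 1 \<longrightarrow> Re (f (of_real r)) > 0)"

definition T_H :: "(complex \<Rightarrow> complex) set" where
  "T_H = {f. \<exists>h g. T_H_repr f h g}"

definition T_H_O :: "(complex \<Rightarrow> complex) set" where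
  "T_H_O = {f. \<exists>h g. T_H_repr f h g \<and> deriv g 0 = 0}"

end

theory Submission
  imports Defs
begin

text \<open>
  Write \<open>f = h + cnj g\<close>, \<open>\<phi> = h - g\<close> and \<open>\<psi> = h + g\<close>, so that \<open>f = Re \<psi> + \<i> Im \<phi>\<close>.  Two facts about the
  analytic pair \<open>(\<phi>, \<psi>)\<close> carry the proof.  Since \<open>f\<close> is real exactly on the real axis, so is \<open>\<phi>\<close>; up
  to sign, \<open>\<phi>\<close> is typically real.  Since \<open>f\<close> is sense-preserving, \<open>\<psi>'/\<phi>' = (1 + \<omega>)/(1 - \<omega>)\<close> has positive
  real part wherever \<open>\<phi>' \<noteq> 0\<close>.

  Shearing (\<open>shear_inj_on\<close>): on a domain where \<open>\<phi>\<close> is injective and its image meets every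
  horizontal line in an interval, \<open>f\<close> is injective.  Two points with equal value under \<open>f\<close> lie on
  one level curve of \<open>Im \<phi>\<close>, which \<open>\<phi>\<close> maps onto a horizontal segment; along it \<open>Re \<psi>\<close> has
  derivative \<open>Re (\<psi>'/\<phi>')\<close> with respect to \<open>\<phi>\<close>, hence is strictly monotone.

  So it remains to show that \<open>\<phi>\<close> maps the two domains injectively onto horizontally convex sets.
  Through the univalent map \<open>z \<mapsto> 2z/(1 + z\<^sup>2)\<close>, the domain in (b) becomes a disk as well.  On a disk,
  horizontal convexity follows if \<open>Im \<phi>\<close> takes no value three times on bounding circles
  (\<open>horizontally_convex_image\<close>), and for this it is enough that on each of the two half circles every
  critical point of \<open>Im \<phi>\<close> as a function of the angle is a strict extremum of the same kind
  (\<open>circle_Im_no_three_equal_values\<close>).  With \<open>D = z\<phi>'\<close> and \<open>N = z(z\<phi>')'\<close> this says: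
  \<open>Re D = 0\<close> implies \<open>Im z \<cdot> Im N > 0\<close>.

  A typically real function is, up to an additive constant, an average of the Koebe-type kernels
  \<open>z/(1 - 2tz + z\<^sup>2)\<close>, \<open>-1 \<le> t \<le> 1\<close>, with nonnegative weights (\<open>typically_real_representation\<close>).  The
  implication above is not linear in \<open>\<phi>\<close>, but a Lagrange multiplier makes it so: if for each \<open>z\<close>
  there is a real \<open>l\<close> such that \<open>Im z \<cdot> Im N + l \<cdot> Re D > 0\<close> for all kernels, then the implication holds
  for all averages.  Finding \<open>l\<close> is a problem about real polynomials, and it is solved below up
  to the two radii in the theorem.  In the variable \<open>\<zeta> = 2z/(1 + z\<^sup>2)\<close> the kernels are
  \<open>\<zeta>/(2(1 - t\<zeta>))\<close>, which gives the second radius.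

  To have a weight given by boundary values, everything is applied to \<open>z \<mapsto> f (\<rho>z)\<close> with
  \<open>\<rho> < 1\<close>; letting \<open>\<rho>\<close> tend to 1 loses nothing, since both domains are open.
\<close>

section \<open>The polynomial inequalities behind the two radii\<close>

text \<open>
  On the circle of radius \<open>r\<close> put \<open>z = r(x + \<i>y)\<close> and \<open>A = 1/r + r\<close>; here \<open>t\<close> stands for twice the kernel
  parameter.  The left-hand side is, up to positive factors,
  \<open>Im z \<cdot> Im (z(zK')') + l \<cdot> Re (zK')\<close> for one kernel \<open>K\<close>, with the multiplier \<open>l\<close> chosen such that the part that is odd in \<open>t\<close> vanishes at the
  extreme parameters \<open>t = 2\<close> and \<open>t = -2\<close>.  That is why the rest splits off a factor \<open>4 - t\<^sup>2\<close>.
\<close>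

lemma koebe_kernel_identity:
  fixes A x y t :: real
  assumes xy: "x\<^sup>2 + y\<^sup>2 = 1"
  defines "D \<equiv> A\<^sup>2 * (1 + x\<^sup>2) + 12 * x\<^sup>2 - 4 * x^4"
  shows "D * ((A\<^sup>2 * x\<^sup>2 - (A\<^sup>2 - 4) * y\<^sup>2 + t * A * x - 8) * (3 * (A * x - t)\<^sup>2 - (A\<^sup>2 - 4) * y\<^sup>2)
            - (2 * A * x + t) * ((A * x - t)^3 - 3 * (A * x - t) * ((A\<^sup>2 - 4) * y\<^sup>2)))
       + (A\<^sup>2 + 24 + 4 * x\<^sup>2) * x
          * ((x * ((A * x - t)\<^sup>2 - (A\<^sup>2 - 4) * y\<^sup>2) + 2 * A * y\<^sup>2 * (A * x - t))
              * ((A * x - t)\<^sup>2 + (A\<^sup>2 - 4) * y\<^sup>2))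
     = ((A\<^sup>2)\<^sup>2 - 24 * A\<^sup>2 - 24 * A\<^sup>2 * x\<^sup>2 - 96 * x\<^sup>2 + 16 * x^4) * D
       + (A\<^sup>2 + 24 + 4 * x\<^sup>2) * x\<^sup>2 * ((A\<^sup>2)\<^sup>2 + 24 * A\<^sup>2 + 32 * x\<^sup>2 - 16 * x^4)
       + (4 - t\<^sup>2) * ((6 * A\<^sup>2 + 24 * x\<^sup>2 - 4 - t\<^sup>2) * D
            - (6 * A\<^sup>2 + 4 + t\<^sup>2) * x\<^sup>2 * (A\<^sup>2 + 24 + 4 * x\<^sup>2)
            + 2 * (A * x * t) * (24 + 16 * x\<^sup>2 + 8 * x^4))"
proof -
  have y: "y\<^sup>2 = 1 - x\<^sup>2" using xy by simp
  show ?thesis unfolding D_def y by algebra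
qed

text \<open>
  The bound \<open>A\<^sup>2 > 24\<close> is the condition \<open>r < \<surd>6 - \<surd>5\<close>.  It is sharp for this expression: at \<open>x = 0\<close> and
  \<open>t = 2\<close> the value is \<open>A\<^sup>4(A\<^sup>2 - 24)\<close>.
\<close>

lemma koebe_kernel_poly_pos:
  fixes A x y t :: real
  assumes xy: "x\<^sup>2 + y\<^sup>2 = 1" and A: "A\<^sup>2 > 24" and t: "\<bar>t\<bar> \<le> 2"
  shows "(A\<^sup>2 * (1 + x\<^sup>2) + 12 * x\<^sup>2 - 4 * x^4) * ((A\<^sup>2 * x\<^sup>2 - (A\<^sup>2 - 4) * y\<^sup>2 + t * A * x - 8) * (3 * (A * x - t)\<^sup>2 - (A\<^sup>2 - 4) * y\<^sup>2)
            - (2 * A * x + t) * ((A * x - t)^3 - 3 * (A * x - t) * ((A\<^sup>2 - 4) * y\<^sup>2)))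
       + (A\<^sup>2 + 24 + 4 * x\<^sup>2) * x
          * ((x * ((A * x - t)\<^sup>2 - (A\<^sup>2 - 4) * y\<^sup>2) + 2 * A * y\<^sup>2 * (A * x - t))
              * ((A * x - t)\<^sup>2 + (A\<^sup>2 - 4) * y\<^sup>2)) > 0"
proof -
  define a X T where "a = A\<^sup>2" and "X = x\<^sup>2" and "T = t\<^sup>2"
  define D where "D = a * (1 + X) + 12 * X - 4 * X\<^sup>2"
  have X: "0 \<le> X" "X \<le> 1" using xy unfolding X_def by (auto, smt (verit) zero_le_power2)
  have a: "a > 24" using A by (simp add: a_def)
  have T: "0 \<le> T" "T \<le> 4" using t abs_le_square_iff[of t 2] unfolding T_def by auto
  have X2: "0 \<le> X\<^sup>2" "X\<^sup>2 \<le> X" "X^3 \<le> 1" "0 \<le> X^3" using X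
    by (auto simp: power2_eq_square mult_left_le power_le_one)
  have aX: "0 \<le> a * X" "a * X \<le> a" using a X by (auto simp: mult_left_le)
  have aX2: "0 \<le> a * X\<^sup>2" "a * X\<^sup>2 \<le> a" using a X X2 by (auto intro: mult_left_le)
  have Dlo: "D > 0"
  proof -
    have "D = a + a * X + 12 * X - 4 * X\<^sup>2" by (simp add: D_def algebra_simps)
    thus ?thesis using a aX X X2 by linarith
  qed
  have Dhi: "D \<le> 2 * a + 8"
  proof -
    have "12 * X - 4 * X\<^sup>2 \<le> 8" using zero_le_power2[of "X-1"] X2 X by (simp add: power2_eq_square algebra_simps)
    thus ?thesis using aX unfolding D_def by (simp add: algebra_simps)
  qed
  have S: "(a\<^sup>2 - 24 * a - 24 * a * X - 96 * X + 16 * X\<^sup>2) * D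
       + (a + 24 + 4 * X) * X * (a\<^sup>2 + 24 * a + 32 * X - 16 * X\<^sup>2) > 0"
  proof -
    have "(24 * a + 96) * X * D \<le> (24 * a + 96) * X * (2 * a + 8)"
      using Dhi a X by (intro mult_left_mono) auto
    also have "\<dots> \<le> X * ((a + 24) * (a\<^sup>2 + 24 * a))"
    proof -
      have "(24 * a + 96) * (2 * a + 8) \<le> (a + 24) * (a\<^sup>2 + 24 * a)"
      proof -
        have "(a + 24) * (a\<^sup>2 + 24 * a) - (24 * a + 96) * (2 * a + 8) = a^3 + (192 * a - 768)"
          by (simp add: algebra_simps power2_eq_square power3_eq_cube)
        moreover have "a^3 \<ge> 0" using a by simp
        ultimately show ?thesis using a by linarith
      qed
      from mult_left_mono[OF this X(1)] show ?thesis by (simp add: mult_ac)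
    qed
    also have "\<dots> \<le> X * ((a + 24 + 4 * X) * (a\<^sup>2 + 24 * a + 32 * X - 16 * X\<^sup>2))"
      using X X2 a by (intro mult_left_mono mult_mono) auto
    finally have 1: "(24 * a + 96) * X * D \<le> X * ((a + 24 + 4 * X) * (a\<^sup>2 + 24 * a + 32 * X - 16 * X\<^sup>2))" .
    have 2: "(a * (a - 24) + 16 * X\<^sup>2) * D > 0"
      using a Dlo X2 by (intro mult_pos_pos add_pos_nonneg) auto
    from 1 2 show ?thesis by (simp add: algebra_simps power2_eq_square)
  qed
  \<comment> \<open>The AM-GM weights are tuned to \<open>x\<^sup>2 = 1\<close>, \<open>A\<^sup>2 \<approx> 25\<close>, where the bracket is tightest.\<close>
  have pt: "2 * (A * x * t) \<ge> - (2/5) * (a + 25 * X)"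
  proof -
    have "\<bar>A * x * t\<bar> \<le> \<bar>A * x\<bar> * 2" using t by (simp add: abs_mult mult_left_mono)
    moreover have "5 * \<bar>A * x\<bar> * 2 \<le> a + 25 * X"
      using zero_le_power2[of "\<bar>A\<bar> - 5 * \<bar>x\<bar>"] by (simp add: a_def X_def power2_eq_square algebra_simps abs_mult)
    moreover have "- \<bar>A * x * t\<bar> \<le> A * x * t" by linarith
    ultimately show ?thesis by argo
  qed
  \<comment> \<open>With \<open>t\<^sup>2\<close> replaced by its worst value 4, what remains is quadratic in \<open>a\<close> with leading term \<open>6a\<^sup>2\<close>.\<close>
  have br: "(6 * a + 24 * X - 4 - T) * D - (6 * a + 4 + T) * X * (a + 24 + 4 * X)
            + 2 * (A * x * t) * (24 + 16 * X + 8 * X\<^sup>2) > 0"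
  proof -
    have 1: "2 * (A * x * t) * (24 + 16 * X + 8 * X\<^sup>2) \<ge> - (2/5) * (a + 25 * X) * (24 + 16 * X + 8 * X\<^sup>2)"
      using X X2 by (intro mult_right_mono[OF pt]) auto
    have 2: "(6 * a + 24 * X - 4 - T) * D \<ge> (6 * a + 24 * X - 8) * D"
      using Dlo T by (intro mult_right_mono) auto
    have 3: "(6 * a + 4 + T) * X * (a + 24 + 4 * X) \<le> (6 * a + 8) * X * (a + 24 + 4 * X)"
      using T X a by (intro mult_right_mono) auto
    have id: "(6 * a + 24 * X - 8) * D - (6 * a + 8) * X * (a + 24 + 4 * X)
         - (2/5) * (a + 25 * X) * (24 + 16 * X + 8 * X\<^sup>2)
       = 6 * a\<^sup>2 - (17.6 * a + 70.4 * (a * X) + 27.2 * (a * X\<^sup>2)) - (528 * X - 128 * X\<^sup>2 + 176 * X^3)"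
      unfolding D_def by (simp add: algebra_simps power2_eq_square power3_eq_cube)
    have "a * a > 24 * a" using a by (simp)
    hence "6 * a\<^sup>2 > 144 * a" by (simp add: power2_eq_square)
    moreover have "528 * X - 128 * X\<^sup>2 + 176 * X^3 \<le> 576"
    proof -
      have "X^3 \<le> X\<^sup>2" using X by (simp add: power_decreasing)
      thus ?thesis using X2 X by linarith
    qed
    ultimately have "(6 * a + 24 * X - 8) * D - (6 * a + 8) * X * (a + 24 + 4 * X)
         - (2/5) * (a + 25 * X) * (24 + 16 * X + 8 * X\<^sup>2) > 0"
      using aX aX2 a unfolding id by linarith
    with 1 2 3 show ?thesis by linarith
  qed
  have "(4 - T) * ((6 * a + 24 * X - 4 - T) * D - (6 * a + 4 + T) * X * (a + 24 + 4 * X)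
            + 2 * (A * x * t) * (24 + 16 * X + 8 * X\<^sup>2)) \<ge> 0"
    using br T by (intro mult_nonneg_nonneg) auto
  with S show ?thesis
    by (subst koebe_kernel_identity[OF xy]) (simp add: a_def X_def T_def D_def power_mult[symmetric])
qed

text \<open>
  The multiplier \<open>x/(1 + x\<^sup>2)\<close> cancels the terms that are odd in \<open>a\<close>.  What is left is
  positive because \<open>(1 + a\<^sup>2)\<^sup>2 - 8a\<^sup>2\<close> has its smallest positive zero at \<open>\<surd>2 - 1\<close>.
\<close>

lemma geometric_kernel_poly_pos:
  fixes x y a :: real
  assumes xy: "x\<^sup>2 + y\<^sup>2 = 1" and a: "\<bar>a\<bar> < sqrt 2 - 1"
  shows "(1 + x\<^sup>2) * ((1 - a\<^sup>2)\<^sup>2 + 2 * a * ((1 + a\<^sup>2) * x - 2 * a)) + x * (((1 + a\<^sup>2) * x - 2 * a) * (1 - 2 * a * x + a\<^sup>2)) > 0"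
proof -
  have "(1 + x\<^sup>2) * ((1 - a\<^sup>2)\<^sup>2 + 2 * a * ((1 + a\<^sup>2) * x - 2 * a)) + x * (((1 + a\<^sup>2) * x - 2 * a) * (1 - 2 * a * x + a\<^sup>2))
     = (1 + x\<^sup>2) * ((1 + a\<^sup>2)\<^sup>2 - 8 * a\<^sup>2) + x\<^sup>2 * ((1 + a\<^sup>2)\<^sup>2 + 4 * a\<^sup>2)"
    by algebra
  moreover have "(1 + a\<^sup>2)\<^sup>2 - 8 * a\<^sup>2 > 0"
  proof -
    have s: "sqrt 2 * sqrt 2 = (2::real)" by simp
    have "(sqrt 2 - \<bar>a\<bar>) > 1" using a by linarith
    hence "(sqrt 2 - \<bar>a\<bar>)\<^sup>2 > 1" by (simp add: one_less_power)
    hence "1 + a\<^sup>2 - 2 * sqrt 2 * \<bar>a\<bar> > 0" by (simp add: power2_eq_square algebra_simps s)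
    moreover have "1 + a\<^sup>2 + 2 * sqrt 2 * \<bar>a\<bar> > 0" by (intro add_pos_nonneg) (auto simp: add_pos_nonneg)
    ultimately have "(1 + a\<^sup>2 - 2 * sqrt 2 * \<bar>a\<bar>) * (1 + a\<^sup>2 + 2 * sqrt 2 * \<bar>a\<bar>) > 0" by simp
    thus ?thesis by (simp add: power2_eq_square algebra_simps s)
  qed
  ultimately show ?thesis by (simp add: add_pos_nonneg)
qed

section \<open>Horizontal convexity and shearing\<close>

lemma strict_local_max_if_DERIV2_neg:
  fixes v v1 :: "real \<Rightarrow> real"
  assumes "a < x" "x < b"
    and v: "\<And>u. a < u \<Longrightarrow> u < b \<Longrightarrow> (v has_real_derivative v1 u) (at u)"
    and v1: "v1 x = 0" "(v1 has_real_derivative l) (at x)" "l < 0"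
  shows "\<exists>d>0. \<forall>u. u \<noteq> x \<longrightarrow> \<bar>u - x\<bar> < d \<longrightarrow> v u < v x"
proof -
  obtain d1 where d1: "d1 > 0" "\<And>h. h > 0 \<Longrightarrow> h < d1 \<Longrightarrow> v1 (x - h) > 0"
    using DERIV_neg_dec_left[OF v1(2,3)] v1(1) by auto
  obtain d2 where d2: "d2 > 0" "\<And>h. h > 0 \<Longrightarrow> h < d2 \<Longrightarrow> v1 (x + h) < 0"
    using DERIV_neg_dec_right[OF v1(2,3)] v1(1) by auto
  define d where "d = Min {d1, d2, x - a, b - x}"
  have d: "d > 0" "d \<le> d1" "d \<le> d2" "d \<le> x - a" "d \<le> b - x"
    using d1 d2 assms(1,2) by (auto simp: d_def)
  show ?thesis
  proof (intro exI[of _ d] conjI allI impI d(1))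
    fix u assume u: "u \<noteq> x" "\<bar>u - x\<bar> < d"
    show "v u < v x"
    proof (cases "u < x")
      case True
      obtain c where c: "u < c" "c < x" "v x - v u = (x - u) * v1 c"
        using MVT2[of u x v v1] True v u d by (auto simp: abs_if)
      have "v1 (x - (x - c)) > 0" using c u d by (intro d1) (auto simp: abs_if split: if_splits)
      hence "(x - u) * v1 c > 0" using True by simp
      thus ?thesis using c by linarith
    next
      case False
      hence xu: "x < u" using u by simp
      obtain c where c: "x < c" "c < u" "v u - v x = (u - x) * v1 c"
        using MVT2[of x u v v1] xu v u d by (auto simp: abs_if)
      have "v1 (x + (c - x)) < 0" using c u d by (intro d2) (auto simp: abs_if split: if_splits)
      hence "(u - x) * v1 c < 0" using xu by (simp add: mult_pos_neg)
      thus ?thesis using c by linarith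
    qed
  qed
qed

text \<open>
  By Rolle there would be two critical points.  Between them, a minimum over the closed interval
  they bound would be critical as well, but every critical point is a strict local maximum.
\<close>

lemma no_three_ordered_equal_values:
  fixes v v1 v2 :: "real \<Rightarrow> real"
  assumes v: "\<And>u. a < u \<Longrightarrow> u < b \<Longrightarrow> (v has_real_derivative v1 u) (at u)"
    and v1: "\<And>u. a < u \<Longrightarrow> u < b \<Longrightarrow> (v1 has_real_derivative v2 u) (at u)"
    and crit: "\<And>u. a < u \<Longrightarrow> u < b \<Longrightarrow> v1 u = 0 \<Longrightarrow> v2 u < 0"
    and ord: "a < x" "x < y" "y < z" "z < b"
    and eq: "v x = v y" "v y = v z"
  shows False
proof -
  have cont: "continuous_on {p..q} v" if "a < p" "q < b" for p q
    using that by (intro continuous_at_imp_continuous_on ballI DERIV_isCont[OF v]) auto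
  have rolle: "\<exists>c. p < c \<and> c < q \<and> v1 c = 0" if pq: "a < p" "p < q" "q < b" "v p = v q" for p q
  proof -
    obtain c where c: "p < c" "c < q" "v q - v p = (q - p) * v1 c"
      using MVT2[of p q v v1] pq v by auto
    thus ?thesis using pq by auto
  qed
  obtain p where p: "x < p" "p < y" "v1 p = 0" using rolle[of x y] ord eq by auto
  obtain q where q: "y < q" "q < z" "v1 q = 0" using rolle[of y z] ord eq by auto
  obtain m where m: "m \<in> {p..q}" "\<And>u. u \<in> {p..q} \<Longrightarrow> v m \<le> v u"
    using continuous_attains_inf[of "{p..q}" v] cont[of p q] p q ord by auto
  have m0: "v1 m = 0"
  proof (cases "p < m \<and> m < q")
    case True
    define d where "d = min (m - p) (q - m)"
    show ?thesis
      by (rule DERIV_local_min[of v "v1 m" m d]) (use True v m p q ord in \<open>auto simp: d_def abs_if split: if_splits\<close>)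
  next
    case False
    thus ?thesis using m p q by (auto simp: not_less)
  qed
  have mab: "a < m" "m < b" using m p q ord by auto
  obtain d where d: "d > 0" "\<And>u. u \<noteq> m \<Longrightarrow> \<bar>u - m\<bar> < d \<Longrightarrow> v u < v m"
  proof -
    have "\<exists>d>0. \<forall>u. u \<noteq> m \<longrightarrow> \<bar>u - m\<bar> < d \<longrightarrow> v u < v m"
      by (rule strict_local_max_if_DERIV2_neg[OF mab _ m0 v1[OF mab] crit[OF mab m0]]) (rule v)
    thus ?thesis using that by blast
  qed
  define h where "h = min (d/2) ((q - p) / 2)"
  have h: "0 < h" "h < d" using d p q by (auto simp: h_def)
  have "h \<le> (q - p) / 2" by (simp only: h_def min.cobounded2)
  \<comment> \<open>The interval is at least \<open>2h\<close> long, so one of the two neighbours of \<open>m\<close> stays inside.\<close>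
  have "m - h \<in> {p..q} \<or> m + h \<in> {p..q}" using m(1) h \<open>h \<le> (q - p) / 2\<close> by (auto simp: field_simps)
  thus False using d(2)[of "m - h"] d(2)[of "m + h"] m(2)[of "m - h"] m(2)[of "m + h"] h by force
qed

lemma no_three_equal_values:
  fixes v v1 v2 :: "real \<Rightarrow> real"
  assumes v: "\<And>u. a < u \<Longrightarrow> u < b \<Longrightarrow> (v has_real_derivative v1 u) (at u)"
    and v1: "\<And>u. a < u \<Longrightarrow> u < b \<Longrightarrow> (v1 has_real_derivative v2 u) (at u)"
    and crit: "\<And>u. a < u \<Longrightarrow> u < b \<Longrightarrow> v1 u = 0 \<Longrightarrow> v2 u < 0"
    and "a < x" "x < b" "a < y" "y < b" "a < z" "z < b"
    and "v x = v y" "v y = v z" "x \<noteq> y" "y \<noteq> z" "x \<noteq> z"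
  shows False
proof -
  have *: False if "a < p" "p < q" "q < s" "s < b" "v p = v q" "v q = v s" for p q s
    by (rule no_three_ordered_equal_values[of a b v v1 v2 p q s]) (fact | rule v v1 crit; assumption)+
  consider "x < y" "y < z" | "x < z" "z < y" | "y < x" "x < z" | "y < z" "z < x" | "z < x" "x < y" | "z < y" "y < x"
    using assms(12-14) by linarith
  thus False
    by cases (use assms(4-11) in \<open>auto intro: *[of x y z] *[of x z y] *[of y x z] *[of y z x] *[of z x y] *[of z y x]\<close>)
qed

text \<open>
  A missing point between \<open>p\<close> and \<open>q\<close> forces a frontier point below \<open>p\<close>, one between
  \<open>p\<close> and the missing point, and one above \<open>q\<close>.
\<close>

lemma mem_if_between_and_frontier_le_2:
  fixes S :: "real set"
  assumes S: "open S" "bounded S"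
    and fr: "\<And>x y z. x \<in> frontier S \<Longrightarrow> y \<in> frontier S \<Longrightarrow> z \<in> frontier S \<Longrightarrow> x < y \<Longrightarrow> y < z \<Longrightarrow> False"
    and p: "p \<in> S" and q: "q \<in> S" and w: "p < w" "w < q"
  shows "w \<in> S"
proof (rule ccontr)
  assume wS: "w \<notin> S"
  have fron: "\<exists>x\<in>frontier S. x \<in> closed_segment u v" if "u \<in> S" "v \<notin> S" for u v
  proof -
    have "closed_segment u v \<inter> frontier S \<noteq> {}"
      by (rule connected_Int_frontier) (use that in auto)
    thus ?thesis by auto
  qed
  obtain B where B: "\<And>x. x \<in> S \<Longrightarrow> \<bar>x\<bar> \<le> B" using S(2) by (auto simp: bounded_iff)
  have BS: "B + 1 \<notin> S" "-(B+1) \<notin> S" using B[of "B+1"] B[of "-(B+1)"] by auto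
  have pq: "\<bar>p\<bar> \<le> B" "\<bar>q\<bar> \<le> B" using B p q by auto
  have not: "x \<notin> frontier S" if "x \<in> S" for x using S(1) that by (simp add: frontier_def interior_open)
  obtain x where x: "x \<in> frontier S" "x \<in> closed_segment p (-(B+1))" using fron[OF p BS(2)] by auto
  obtain y where y: "y \<in> frontier S" "y \<in> closed_segment p w" using fron[OF p wS] by auto
  obtain z where z: "z \<in> frontier S" "z \<in> closed_segment q (B+1)" using fron[OF q BS(1)] by auto
  have "x \<le> p" "x \<noteq> p" "p \<le> y" "y \<le> w" "q \<le> z" using x y z w pq not p
    by (auto simp: closed_segment_eq_real_ivl split: if_splits)
  thus False using fr[OF x(1) y(1) z(1)] w by linarith
qed

text \<open>
  With \<open>z = r e\<^sup>i\<^sup>\<theta>\<close> the first two derivatives of \<open>Im \<Phi>\<close> in \<open>\<theta>\<close> are \<open>Re (z \<Phi>')\<close> and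
  \<open>- Im (z \<Phi>' + z\<^sup>2 \<Phi>'')\<close>, so \<open>crit\<close> says that critical points in the upper half plane are strict
  maxima, and those in the lower half plane strict minima.  The sign condition confines a level
  set to a single half circle.
\<close>

lemma circle_Im_no_three_equal_values:
  fixes \<Phi> :: "complex \<Rightarrow> complex"
  assumes hol: "\<Phi> holomorphic_on ball 0 R" and r: "0 < r" "r < R"
    and real: "\<And>z. z \<in> ball 0 R \<Longrightarrow> Im z = 0 \<Longrightarrow> Im (\<Phi> z) = 0"
    and sign: "\<And>z. z \<in> ball 0 R \<Longrightarrow> Im z \<noteq> 0 \<Longrightarrow> Im z * Im (\<Phi> z) > 0"
    and crit: "\<And>z. norm z = r \<Longrightarrow> Im z \<noteq> 0 \<Longrightarrow> Re (z * deriv \<Phi> z) = 0 \<Longrightarrow>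
                 Im z * Im (z * deriv \<Phi> z + z\<^sup>2 * deriv (deriv \<Phi>) z) > 0"
    and z: "norm z1 = r" "norm z2 = r" "norm z3 = r"
    and eq: "Im (\<Phi> z1) = c" "Im (\<Phi> z2) = c" "Im (\<Phi> z3) = c"
    and ne: "z1 \<noteq> z2" "z2 \<noteq> z3" "z1 \<noteq> z3"
  shows False
proof (cases "c = 0")
  case True
  have "z = of_real r \<or> z = - of_real r" if "norm z = r" "Im (\<Phi> z) = c" for z
  proof -
    have "Im z = 0" using sign[of z] that True r by force
    hence "\<bar>Re z\<bar> = r" using that(1) by (simp add: cmod_def)
    thus ?thesis using \<open>Im z = 0\<close> by (auto simp: complex_eq_iff abs_if split: if_splits)
  qed
  from this[OF z(1) eq(1)] this[OF z(2) eq(2)] this[OF z(3) eq(3)] ne show False by metis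
next
  case False
  define s where "s = sgn c"
  have s: "s = 1 \<or> s = -1" "s * s = 1" using False by (auto simp: s_def sgn_if)
  \<comment> \<open>For \<open>c < 0\<close> the lower half circle is traversed clockwise, so that \<open>v\<close> has maxima in both cases.\<close>
  define C where "C = (\<lambda>u::real. of_real r * cis (s * u))"
  define v where "v = (\<lambda>u. s * Im (\<Phi> (C u)))"
  define v1 where "v1 = (\<lambda>u. Re (C u * deriv \<Phi> (C u)))"
  define v2 where "v2 = (\<lambda>u. - s * Im (C u * deriv \<Phi> (C u) + (C u)\<^sup>2 * deriv (deriv \<Phi>) (C u)))"
  have normC: "norm (C u) = r" for u using r by (simp add: C_def norm_mult)
  have inB: "C u \<in> ball 0 R" for u using normC r by simp
  have ImC: "Im (C u) = r * (s * sin u)" for u using s by (auto simp: C_def)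
  have dC: "(C has_vector_derivative (\<i> * of_real s * C u)) (at u)" for u
  proof -
    have "((\<lambda>w. of_real r * exp (\<i> * of_real s * w)) has_field_derivative (\<i> * of_real s * C u)) (at (of_real u))"
      by (auto intro!: derivative_eq_intros simp: C_def cis_conv_exp mult_ac)
    from has_vector_derivative_real_field[OF this] show ?thesis by (simp add: C_def o_def cis_conv_exp mult_ac)
  qed
  have hol': "deriv \<Phi> holomorphic_on ball 0 R" by (intro holomorphic_deriv hol) auto
  have d\<Phi>: "(\<Phi> has_field_derivative deriv \<Phi> (C u)) (at (C u))" for u
    using hol inB holomorphic_derivI by blast
  have d\<Phi>': "(deriv \<Phi> has_field_derivative deriv (deriv \<Phi>) (C u)) (at (C u))" for u
    using hol' inB holomorphic_derivI by blast
  have dv: "(v has_real_derivative v1 u) (at u)" for u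
  proof -
    have "((\<Phi> \<circ> C) has_vector_derivative (\<i> * of_real s * C u) * deriv \<Phi> (C u)) (at u)"
      by (rule field_vector_diff_chain_at[OF dC d\<Phi>])
    from bounded_linear.has_vector_derivative[OF bounded_linear_Im this]
    have "((\<lambda>u. Im (\<Phi> (C u))) has_real_derivative s * v1 u) (at u)"
      by (simp add: has_real_derivative_iff_has_vector_derivative v1_def algebra_simps o_def)
    from DERIV_cmult[OF this, of s] show ?thesis using s by (auto simp: v_def)
  qed
  have dv1: "(v1 has_real_derivative v2 u) (at u)" for u
  proof -
    have "((\<lambda>w. w * deriv \<Phi> w) has_field_derivative (deriv \<Phi> (C u) + C u * deriv (deriv \<Phi>) (C u))) (at (C u))"
      by (auto intro!: derivative_eq_intros d\<Phi>')
    from field_vector_diff_chain_at[OF dC this]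
    have "(((\<lambda>w. w * deriv \<Phi> w) \<circ> C) has_vector_derivative (\<i> * of_real s * C u) * (deriv \<Phi> (C u) + C u * deriv (deriv \<Phi>) (C u))) (at u)" .
    from bounded_linear.has_vector_derivative[OF bounded_linear_Re this]
    show ?thesis
      by (simp add: has_real_derivative_iff_has_vector_derivative v1_def v2_def algebra_simps o_def power2_eq_square)
  qed
  have cr: "v2 u < 0" if "0 < u" "u < pi" "v1 u = 0" for u
  proof -
    have "sin u > 0" using that by (simp add: sin_gt_zero)
    hence "Im (C u) \<noteq> 0" using r s by (auto simp: ImC)
    from crit[OF normC this] that
    have "Im (C u) * Im (C u * deriv \<Phi> (C u) + (C u)\<^sup>2 * deriv (deriv \<Phi>) (C u)) > 0"
      unfolding v1_def by blast
    moreover have "Im (C u * deriv \<Phi> (C u) + (C u)\<^sup>2 * deriv (deriv \<Phi>) (C u)) = - s * v2 u"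
      by (simp only: v2_def mult_minus_left mult_minus_right minus_minus mult.assoc[symmetric] s(2) mult_1)
    ultimately have "Im (C u) * (- s * v2 u) > 0" by simp
    hence "r * sin u * (- v2 u) > 0" using s by (auto simp: ImC)
    thus ?thesis using r \<open>sin u > 0\<close> by (simp add: mult_less_0_iff zero_less_mult_iff)
  qed
  have par: "\<exists>u. 0 < u \<and> u < pi \<and> z = C u" if "norm z = r" "Im (\<Phi> z) = c" for z
  proof -
    have zB: "z \<in> ball 0 R" using that r by simp
    have "Im z \<noteq> 0" using real[OF zB] that False by auto
    from sign[OF zB this] that have pos: "s * Im z > 0" using False by (auto simp: s_def sgn_if zero_less_mult_iff)
    have z0: "z \<noteq> 0" using that r by auto
    have "z = of_real r * cis (Arg z)" using z0 that
      by (metis rcis_cmod_Arg rcis_def)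
    hence "z = C (s * Arg z)" using s by (auto simp: C_def)
    moreover have "0 < s * Arg z \<and> s * Arg z < pi"
    proof (cases "s = 1")
      case True
      thus ?thesis using pos Arg_lt_pi[of z] by simp
    next
      case s1: False
      hence "s = -1" "Im z < 0" using s pos by auto
      thus ?thesis using Arg_neg_iff[of z] mpi_less_Arg[of z] by auto
    qed
    ultimately show ?thesis by blast
  qed
  obtain u1 u2 u3 where u: "0 < u1" "u1 < pi" "z1 = C u1" "0 < u2" "u2 < pi" "z2 = C u2" "0 < u3" "u3 < pi" "z3 = C u3"
    using par[OF z(1) eq(1)] par[OF z(2) eq(2)] par[OF z(3) eq(3)] by blast
  show False
    by (rule no_three_equal_values[of 0 pi v v1 v2 u1 u2 u3]) (use dv dv1 cr u eq ne in \<open>auto simp: v_def\<close>)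
qed

text \<open>
  On a horizontal line the image of the open disk is open and bounded, and its frontier
  points are values on the bounding circle; there are at most two of them.
\<close>

lemma horizontally_convex_image:
  fixes \<Phi> :: "complex \<Rightarrow> complex"
  assumes hol: "\<Phi> holomorphic_on ball 0 R" and r: "0 < r" "r < R"
    and inj: "inj_on \<Phi> (ball 0 r)"
    and lt3: "\<And>z1 z2 z3. norm z1 = r \<Longrightarrow> norm z2 = r \<Longrightarrow> norm z3 = r \<Longrightarrow> z1 \<noteq> z2 \<Longrightarrow> z2 \<noteq> z3 \<Longrightarrow> z1 \<noteq> z3
        \<Longrightarrow> Im (\<Phi> z1) = Im (\<Phi> z2) \<Longrightarrow> Im (\<Phi> z2) = Im (\<Phi> z3) \<Longrightarrow> False"
    and a: "a \<in> ball 0 r" and b: "b \<in> ball 0 r" and eq: "Im (\<Phi> a) = Im (\<Phi> b)"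
  shows "closed_segment (\<Phi> a) (\<Phi> b) \<subseteq> \<Phi> ` ball 0 r"
proof -
  define c where "c = Im (\<Phi> a)"
  define S where "S = {x. Complex x c \<in> \<Phi> ` ball 0 r}"
  have sub: "ball 0 r \<subseteq> ball 0 R" "cball 0 r \<subseteq> ball 0 R" using r by auto
  have opn: "open (\<Phi> ` ball 0 r)"
    by (rule open_mapping_thm3[OF holomorphic_on_subset[OF hol sub(1)] _ inj]) auto
  have cc: "continuous_on UNIV (\<lambda>x. Complex x c)"
    by (simp add: Complex_eq) (intro continuous_intros)
  have oS: "open S"
  proof -
    have "S = (\<lambda>x. Complex x c) -` (\<Phi> ` ball 0 r)" by (auto simp: S_def)
    thus ?thesis using open_vimage[OF opn cc] by simp
  qed
  have cpt: "compact (\<Phi> ` cball 0 r)"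
    by (intro compact_continuous_image holomorphic_on_imp_continuous_on[OF holomorphic_on_subset[OF hol sub(2)]]) auto
  have bS: "bounded S"
  proof -
    obtain K where K: "\<And>w. w \<in> \<Phi> ` cball 0 r \<Longrightarrow> norm w \<le> K"
      using compact_imp_bounded[OF cpt] by (auto simp: bounded_iff)
    have "norm x \<le> K" if "x \<in> S" for x
    proof -
      have "Complex x c \<in> \<Phi> ` cball 0 r" using that ball_subset_cball by (auto simp: S_def)
      from K[OF this] show ?thesis using abs_Re_le_cmod[of "Complex x c"] by simp
    qed
    thus ?thesis by (auto simp: bounded_iff)
  qed
  have fr: "\<exists>z. norm z = r \<and> \<Phi> z = Complex x c" if "x \<in> frontier S" for x
  proof -
    have cl: "closed ((\<lambda>x. Complex x c) -` (\<Phi> ` cball 0 r))"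
      by (rule closed_vimage[OF compact_imp_closed[OF cpt] cc])
    have "S \<subseteq> (\<lambda>x. Complex x c) -` (\<Phi> ` cball 0 r)" unfolding S_def by force
    hence "closure S \<subseteq> (\<lambda>x. Complex x c) -` (\<Phi> ` cball 0 r)" using cl by (rule closure_minimal)
    moreover have "x \<in> closure S" "x \<notin> S" using that oS by (auto simp: frontier_def interior_open)
    ultimately obtain z where z: "z \<in> cball 0 r" "\<Phi> z = Complex x c" by fastforce
    have "z \<notin> ball 0 r" using z \<open>x \<notin> S\<close> by (force simp: S_def)
    thus ?thesis using z by force
  qed
  have no3: False if xyz: "x \<in> frontier S" "y \<in> frontier S" "z \<in> frontier S" "x < y" "y < z" for x y z
  proof -
    obtain p where p: "norm p = r" "\<Phi> p = Complex x c" using fr[OF xyz(1)] by auto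
    obtain q where q: "norm q = r" "\<Phi> q = Complex y c" using fr[OF xyz(2)] by auto
    obtain t where t: "norm t = r" "\<Phi> t = Complex z c" using fr[OF xyz(3)] by auto
    show False by (rule lt3[of p q t]) (use p q t xyz in auto)
  qed
  have aS: "Re (\<Phi> a) \<in> S" using a by (auto simp: S_def c_def complex.collapse)
  have bS': "Re (\<Phi> b) \<in> S" using b eq by (auto simp: S_def c_def complex.collapse)
  show ?thesis
  proof
    fix w assume w: "w \<in> closed_segment (\<Phi> a) (\<Phi> b)"
    then obtain u where u: "0 \<le> u" "u \<le> 1" "w = (1 - u) *\<^sub>R \<Phi> a + u *\<^sub>R \<Phi> b" by (auto simp: closed_segment_def)
    have "Im w = (1 - u) * Im (\<Phi> a) + u * Im (\<Phi> b)" using u by simp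
    hence Imw: "Im w = c" using eq by (simp add: c_def algebra_simps)
    have Rew: "Re w \<in> closed_segment (Re (\<Phi> a)) (Re (\<Phi> b))" using u by (auto simp: closed_segment_def)
    have "Re w \<in> S"
    proof (cases "Re w = Re (\<Phi> a) \<or> Re w = Re (\<Phi> b)")
      case True thus ?thesis using aS bS' by auto
    next
      case False
      have *: "t \<in> S" if "p \<in> S" "q \<in> S" "p < t" "t < q" for p q t
        by (rule mem_if_between_and_frontier_le_2[OF oS bS _ that]) (rule no3)
      show ?thesis using False *[OF aS bS', of "Re w"] *[OF bS' aS, of "Re w"] Rew
        by (auto simp: closed_segment_eq_real_ivl split: if_splits)
    qed
    hence "Complex (Re w) (Im w) \<in> \<Phi> ` ball 0 r" using Imw by (simp add: S_def)
    thus "w \<in> \<Phi> ` ball 0 r" by simp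
  qed
qed

text \<open>
  The criterion of Noshiro and Warschawski: \<open>f\<close> increases in the direction \<open>b - a\<close> along the segment from
  \<open>a\<close> to \<open>b\<close>.
\<close>

lemma inj_on_if_Re_deriv_pos:
  fixes f :: "complex \<Rightarrow> complex"
  assumes "f holomorphic_on S" "open S" "convex S" "\<And>z. z \<in> S \<Longrightarrow> Re (deriv f z) > 0"
  shows "inj_on f S"
proof (rule inj_onI, rule ccontr)
  fix a b assume ab: "a \<in> S" "b \<in> S" "f a = f b" "a \<noteq> b"
  define g where "g = (\<lambda>u::real. f (a + of_real u * (b - a)))"
  have inS: "a + of_real u * (b - a) \<in> S" if "0 \<le> u" "u \<le> 1" for u
  proof -
    have "(1 - u) *\<^sub>R a + u *\<^sub>R b \<in> S" using assms(3) ab that by (intro convexD) auto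
    thus ?thesis by (simp add: scaleR_conv_of_real algebra_simps)
  qed
  define F where "F = (\<lambda>u::real. Re (g u / (b - a)))"
  have "(F has_real_derivative Re (deriv f (a + of_real u * (b - a)))) (at u)" if "0 \<le> u" "u \<le> 1" for u
  proof -
    have 1: "((\<lambda>u::real. a + of_real u * (b - a)) has_vector_derivative (b - a)) (at u)"
      by (auto intro!: derivative_eq_intros simp: has_vector_derivative_def scaleR_conv_of_real)
    have 2: "(f has_field_derivative deriv f (a + of_real u * (b - a))) (at (a + of_real u * (b - a)))"
      using holomorphic_derivI[OF assms(1,2)] inS that by blast
    from field_vector_diff_chain_at[OF 1 2]
    have "((\<lambda>u. g u / (b - a)) has_vector_derivative ((b - a) * deriv f (a + of_real u * (b - a)) / (b - a))) (at u)"
      unfolding g_def o_def by (rule has_vector_derivative_divide)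
    from bounded_linear.has_vector_derivative[OF bounded_linear_Re this]
    show ?thesis using ab by (simp add: F_def has_real_derivative_iff_has_vector_derivative)
  qed
  from DERIV_pos_imp_increasing[of 0 1 F] this assms(4) inS have "F 0 < F 1" by (metis zero_less_one)
  thus False using ab by (simp add: F_def g_def)
qed

text \<open>
  The shear construction of Clunie and Sheil-Small.  Pulled back by the inverse of
  \<open>\<Phi>\<close>, the function \<open>Re \<Psi>\<close> has derivative \<open>Re (\<Psi>'/\<Phi>') > 0\<close> in the horizontal direction.
\<close>

lemma shear_inj_on:
  fixes \<Phi> \<Psi> :: "complex \<Rightarrow> complex"
  assumes hol: "\<Phi> holomorphic_on S" "\<Psi> holomorphic_on S" and S: "open S"
    and inj: "inj_on \<Phi> S"
    and hc: "\<And>a b. a \<in> S \<Longrightarrow> b \<in> S \<Longrightarrow> Im (\<Phi> a) = Im (\<Phi> b) \<Longrightarrow> closed_segment (\<Phi> a) (\<Phi> b) \<subseteq> \<Phi> ` S"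
    and pos: "\<And>z. z \<in> S \<Longrightarrow> Re (deriv \<Psi> z / deriv \<Phi> z) > 0"
  shows "inj_on (\<lambda>z. Complex (Re (\<Psi> z)) (Im (\<Phi> z))) S"
proof (rule inj_onI, rule ccontr)
  fix a b assume ab: "a \<in> S" "b \<in> S" "Complex (Re (\<Psi> a)) (Im (\<Phi> a)) = Complex (Re (\<Psi> b)) (Im (\<Phi> b))" "a \<noteq> b"
  have seg: "closed_segment (\<Phi> a) (\<Phi> b) \<subseteq> \<Phi> ` S" using hc ab by simp
  have "\<Phi> a \<noteq> \<Phi> b" using inj ab by (auto simp: inj_on_def)
  define d where "d = Re (\<Phi> b) - Re (\<Phi> a)"
  have d: "\<Phi> b - \<Phi> a = of_real d" "d \<noteq> 0" using ab \<open>\<Phi> a \<noteq> \<Phi> b\<close> by (auto simp: d_def complex_eq_iff)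
  obtain g where g: "g holomorphic_on \<Phi> ` S" "\<And>z. z \<in> S \<Longrightarrow> deriv \<Phi> z * deriv g (\<Phi> z) = 1" "\<And>z. z \<in> S \<Longrightarrow> g (\<Phi> z) = z"
    using holomorphic_has_inverse[OF hol(1) S inj] by metis
  have opn: "open (\<Phi> ` S)" by (rule open_mapping_thm3[OF hol(1) S inj])
  define F where "F = (\<lambda>u::real. Re (\<Psi> (g (\<Phi> a + of_real u * of_real d))) / d)"
  have inS: "\<Phi> a + of_real u * of_real d \<in> \<Phi> ` S" if "0 \<le> u" "u \<le> 1" for u
  proof -
    have "\<Phi> a + of_real u * of_real d \<in> closed_segment (\<Phi> a) (\<Phi> b)"
      unfolding closed_segment_def d(1)[symmetric]
      using that by (auto simp: scaleR_conv_of_real algebra_simps intro!: exI[of _ u])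
    thus ?thesis using seg by blast
  qed
  have "\<exists>y. (F has_real_derivative y) (at u) \<and> y > 0" if u: "0 \<le> u" "u \<le> 1" for u
  proof -
    obtain z where z: "z \<in> S" "\<Phi> z = \<Phi> a + of_real u * of_real d" using inS[OF u] by force
    have 1: "((\<lambda>u::real. \<Phi> a + of_real u * of_real d) has_vector_derivative of_real d) (at u)"
      by (auto intro!: derivative_eq_intros simp: has_vector_derivative_def scaleR_conv_of_real)
    have 2: "(g has_field_derivative deriv g (\<Phi> z)) (at (\<Phi> z))"
      using holomorphic_derivI[OF g(1) opn] z by blast
    have 3: "(\<Psi> has_field_derivative deriv \<Psi> z) (at z)" using holomorphic_derivI[OF hol(2) S z(1)] .
    have gz: "g (\<Phi> a + of_real u * of_real d) = z" using g(3)[OF z(1)] z(2) by simp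
    have "((\<Psi> \<circ> g) has_field_derivative deriv \<Psi> z * deriv g (\<Phi> z)) (at (\<Phi> z))"
      by (rule DERIV_chain[OF _ 2]) (use 3 gz z(2) in simp)
    hence 4: "((\<Psi> \<circ> g) has_field_derivative deriv \<Psi> z * deriv g (\<Phi> z)) (at (\<Phi> a + of_real u * of_real d))"
      by (simp add: z)
    have ng: "deriv g (\<Phi> z) = 1 / deriv \<Phi> z" using g(2)[OF z(1)] by (metis mult_zero_left nonzero_eq_divide_eq mult.commute zero_neq_one)
    define w where "w = deriv \<Psi> z / deriv \<Phi> z"
    have "deriv \<Psi> z * deriv g (\<Phi> z) = w" by (simp add: ng w_def)
    from bounded_linear.has_vector_derivative[OF bounded_linear_Re field_vector_diff_chain_at[OF 1 4[unfolded this]]]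
    have "((\<lambda>u. Re (\<Psi> (g (\<Phi> a + of_real u * of_real d)))) has_real_derivative d * Re (deriv \<Psi> z / deriv \<Phi> z)) (at u)"
      by (simp add: has_real_derivative_iff_has_vector_derivative o_def w_def[symmetric])
    from DERIV_cdivide[OF this, of d] have "(F has_real_derivative Re (deriv \<Psi> z / deriv \<Phi> z)) (at u)"
      using d by (simp add: F_def)
    thus ?thesis using pos[OF z(1)] by blast
  qed
  from DERIV_pos_imp_increasing[of 0 1 F] this have "F 0 < F 1" by (metis zero_less_one)
  moreover have "\<Phi> a + of_real d = \<Phi> b" using d by (simp add: algebra_simps)
  ultimately show False using ab g(3) by (simp add: F_def)
qed

section \<open>Averages of kernels\<close>

lemma holomorphic_cnj_commute:
  fixes \<phi> :: "complex \<Rightarrow> complex"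
  assumes hol: "\<phi> holomorphic_on ball 0 R"
    and real: "\<And>z. z \<in> ball 0 R \<Longrightarrow> Im z = 0 \<Longrightarrow> Im (\<phi> z) = 0"
    and z: "z \<in> ball 0 R"
  shows "\<phi> (cnj z) = cnj (\<phi> z)"
proof -
  have R: "R > 0" using z by (metis dist_0_norm le_less_trans mem_ball norm_ge_zero)
  have img: "cnj ` ball 0 R = ball 0 R" by (auto simp: image_iff intro!: bexI[of _ "cnj _"])
  have h1: "(\<lambda>w. \<phi> w - (cnj \<circ> \<phi> \<circ> cnj) w) holomorphic_on ball 0 R"
    by (intro holomorphic_intros hol holomorphic_on_compose_cnj_cnj) (use img hol in auto)
  have lim: "0 islimpt (\<real> \<inter> ball (0::complex) R)"
    unfolding islimpt_approachable
  proof (intro allI impI)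
    fix e :: real assume "e > 0"
    thus "\<exists>x'\<in>\<real> \<inter> ball 0 R. x' \<noteq> 0 \<and> dist x' (0::complex) < e"
      using R by (intro bexI[of _ "of_real (min e R / 2)"]) auto
  qed
  have "\<phi> w - (cnj \<circ> \<phi> \<circ> cnj) w = 0" if "w \<in> ball 0 R" for w
  proof (rule analytic_continuation[OF h1 _ _ _ _ lim _ that])
    fix u assume u: "u \<in> \<real> \<inter> ball (0::complex) R"
    hence "Im (\<phi> u) = 0" using real by (auto simp: complex_is_Real_iff)
    moreover have "cnj u = u" using u by (auto simp: Reals_cnj_iff)
    moreover from calculation have "cnj (\<phi> u) = \<phi> u" by (simp add: complex_eq_iff)
    ultimately show "\<phi> u - (cnj \<circ> \<phi> \<circ> cnj) u = 0" unfolding o_def by (metis diff_self)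
  qed (use R in auto)
  from this[OF z] have "\<phi> z = cnj (\<phi> (cnj z))" by simp
  thus ?thesis by (metis complex_cnj_cnj)
qed

text \<open>
  Robertson's representation, for functions that extend across the unit circle.
  By Cauchy's formula, \<open>\<phi> z - \<phi> 0\<close> is the integral of \<open>\<phi>\<close> over the unit circle, divided by \<open>2\<pi>\<i>\<close>,
  against \<open>1/(u - z) - 1/u - z/(1 - zu)\<close>.  The last term contributes nothing, but with it the kernel
  becomes \<open>- 2\<i> sin \<theta> \<cdot> z/(1 - 2z cos \<theta> + z\<^sup>2)\<close> with respect to normalised arc length.  This is odd in
  \<open>\<theta>\<close>, and \<open>\<phi>\<close> commutes with conjugation, so averaging with the reflected integral replaces \<open>\<phi>\<close> by
  \<open>\<i> Im \<phi>\<close>.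
\<close>

lemma typically_real_representation:
  fixes \<phi> :: "complex \<Rightarrow> complex"
  assumes hol: "\<phi> holomorphic_on ball 0 R" and R: "R > 1"
    and real: "\<And>z. z \<in> ball 0 R \<Longrightarrow> Im z = 0 \<Longrightarrow> Im (\<phi> z) = 0"
    and z: "norm z < 1"
  shows "((\<lambda>s. of_real (2 * Im (\<phi> (cis (2 * pi * s))) * sin (2 * pi * s)) *
            (z / (1 - 2 * of_real (cos (2 * pi * s)) * z + z\<^sup>2))) has_integral (\<phi> z - \<phi> 0)) {0..1}"
proof -
  \<comment> \<open>A radius beyond 1 that avoids the pole at \<open>1/z\<close>.\<close>
  define \<rho> where "\<rho> = min R (2 / (1 + norm z))"
  have \<rho>: "1 < \<rho>" "\<rho> \<le> R"
    using R z by (auto simp: \<rho>_def field_simps add_pos_nonneg)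
  have \<rho>z: "norm (z * u) < 1" if "norm u < \<rho>" for u
  proof -
    have "norm u * (1 + norm z) < 2" using that by (simp add: \<rho>_def field_simps add_pos_nonneg)
    moreover have "norm u * norm z \<le> norm u" if "norm u > 1" using z by (simp add: mult_left_le)
    moreover have "norm u * norm z \<le> norm z" if "norm u \<le> 1" using that by (simp add: mult_left_le_one_le)
    ultimately show ?thesis using z by (cases "norm u > 1") (auto simp: norm_mult mult_ac algebra_simps)
  qed
  have nz1: "1 - z * u \<noteq> 0" if "norm u < \<rho>" for u
    using \<rho>z[OF that] by (metis eq_iff_diff_eq_0 norm_one order_less_irrefl)
  have c1: "((\<lambda>u. \<phi> u / (u - z)) has_contour_integral (2 * of_real pi * \<i> * \<phi> z)) (circlepath 0 1)"
    by (rule Cauchy_integral_circlepath_simple) (use R z in \<open>auto intro: holomorphic_on_subset[OF hol]\<close>)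
  have c2: "((\<lambda>u. \<phi> u / (u - 0)) has_contour_integral (2 * of_real pi * \<i> * \<phi> 0)) (circlepath 0 1)"
    by (rule Cauchy_integral_circlepath_simple) (use R z in \<open>auto intro: holomorphic_on_subset[OF hol]\<close>)
  have c3: "((\<lambda>u. \<phi> u * (z / (1 - z * u))) has_contour_integral 0) (circlepath 0 1)"
  proof (rule Cauchy_theorem_convex_simple[where S = "ball 0 \<rho>"])
    show "(\<lambda>u. \<phi> u * (z / (1 - z * u))) holomorphic_on ball 0 \<rho>"
      by (intro holomorphic_intros holomorphic_on_subset[OF hol]) (use \<rho> nz1 in auto)
  qed (use \<rho> in auto)
  define F where "F = (\<lambda>u. \<phi> u / (u - z) - \<phi> u / (u - 0) - \<phi> u * (z / (1 - z * u)))"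
  have "(F has_contour_integral (2 * of_real pi * \<i> * \<phi> z - 2 * of_real pi * \<i> * \<phi> 0 - 0)) (circlepath 0 1)"
    unfolding F_def by (intro has_contour_integral_diff c1 c2 c3)
  hence "((\<lambda>s. F (circlepath 0 1 s) * vector_derivative (circlepath 0 1) (at s)) has_integral
            (2 * of_real pi * \<i> * \<phi> z - 2 * of_real pi * \<i> * \<phi> 0 - 0)) {0..1}"
    by (simp add: has_contour_integral)
  from has_integral_divide[OF this, of "2 * of_real pi * \<i>"]
  have I1: "((\<lambda>s. F (circlepath 0 1 s) * vector_derivative (circlepath 0 1) (at s) / (2 * of_real pi * \<i>)) has_integral
            (\<phi> z - \<phi> 0)) {0..1}"
    by (simp add: diff_divide_distrib[symmetric] right_diff_distrib[symmetric])
  define k where "k = (\<lambda>s::real. z / (1 - 2 * of_real (cos (2 * pi * s)) * z + z\<^sup>2))"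
  have F_eq: "F (circlepath 0 1 s) * vector_derivative (circlepath 0 1) (at s) / (2 * of_real pi * \<i>) =
     \<phi> (cis (2 * pi * s)) * (- 2 * \<i> * of_real (sin (2 * pi * s)) * k s)" for s
  proof -
    define e where "e = cis (2 * pi * s)"
    have ee: "circlepath 0 1 s = e" by (simp add: circlepath e_def cis_conv_exp mult_ac)
    have ve: "vector_derivative (circlepath 0 1) (at s) = 2 * of_real pi * \<i> * e"
      by (simp add: vector_derivative_circlepath e_def cis_conv_exp mult_ac)
    have n: "norm e = 1" by (simp add: e_def)
    have e0: "e \<noteq> 0" "e - z \<noteq> 0" "1 - z * e \<noteq> 0" using n z nz1[of e] \<rho> by auto
    have einv: "e * cnj e = 1" by (simp add: e_def cis_mult cis_cnj)
    have cs: "2 * of_real (cos (2 * pi * s)) = e + cnj e" "2 * \<i> * of_real (sin (2 * pi * s)) = e - cnj e"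
      by (auto simp: e_def complex_eq_iff)
    have den: "(e - z) * (1 - z * e) = e * (1 - (e + cnj e) * z + z\<^sup>2)"
      using einv by algebra
    hence den0: "1 - (e + cnj e) * z + z\<^sup>2 \<noteq> 0" using e0 by auto
    have "F e * e = \<phi> e * (e / (e - z) - 1 - z * e / (1 - z * e))"
      using e0 by (simp add: F_def algebra_simps diff_divide_distrib)
    also have "e / (e - z) - 1 - z * e / (1 - z * e) = z * (1 - e\<^sup>2) / ((e - z) * (1 - z * e))"
      using e0 by (simp add: divide_simps) algebra
    also have "\<dots> = - (e - cnj e) * (z / (1 - (e + cnj e) * z + z\<^sup>2))"
    proof -
      have num: "z * (1 - e\<^sup>2) = e * (- (e - cnj e) * z)" using einv by algebra
      show ?thesis unfolding den num using e0 by simp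
    qed
    finally have Fe: "F e * e = \<phi> e * (- (e - cnj e) * (z / (1 - (e + cnj e) * z + z\<^sup>2)))" .
    have cancel: "v * (C * e) / C = v * e" if "C \<noteq> 0" for v C :: complex using that by simp
    have "F e * (2 * of_real pi * \<i> * e) / (2 * of_real pi * \<i>) = F e * e" by (rule cancel) simp
    moreover have "- 2 * \<i> * of_real (sin (2 * pi * s)) = - (e - cnj e)" using cs(2) by simp
    ultimately show ?thesis
      unfolding ee ve k_def cs(1) e_def[symmetric] using Fe by simp
  qed
  have I2: "((\<lambda>s. \<phi> (cis (2 * pi * s)) * (- 2 * \<i> * of_real (sin (2 * pi * s)) * k s)) has_integral (\<phi> z - \<phi> 0)) {0..1}"
    using I1 unfolding F_eq .
  \<comment> \<open>The substitution \<open>s \<mapsto> 1 - s\<close> conjugates the points on the circle.\<close>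
  have "((\<lambda>s. \<phi> (cis (2 * pi * (1 - s))) * (- 2 * \<i> * of_real (sin (2 * pi * (1 - s))) * k (1 - s))) has_integral (\<phi> z - \<phi> 0)) {0..1}"
    using has_integral_affinity01[OF I2, of "-1" 1]
    by (simp add: image_affinity_atLeastAtMost_diff)
  also have "(\<lambda>s. \<phi> (cis (2 * pi * (1 - s))) * (- 2 * \<i> * of_real (sin (2 * pi * (1 - s))) * k (1 - s))) =
     (\<lambda>s. cnj (\<phi> (cis (2 * pi * s))) * (2 * \<i> * of_real (sin (2 * pi * s)) * k s))"
  proof
    fix s :: real
    have sc: "sin (2 * pi * (1 - s)) = - sin (2 * pi * s)" "cos (2 * pi * (1 - s)) = cos (2 * pi * s)"
      by (simp_all add: right_diff_distrib sin_diff cos_diff)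
    have "cis (2 * pi * (1 - s)) = cnj (cis (2 * pi * s))" by (simp add: complex_eq_iff sc)
    hence "\<phi> (cis (2 * pi * (1 - s))) = cnj (\<phi> (cis (2 * pi * s)))"
      using holomorphic_cnj_commute[OF hol real, of "cis (2 * pi * s)"] R by simp
    thus "\<phi> (cis (2 * pi * (1 - s))) * (- 2 * \<i> * of_real (sin (2 * pi * (1 - s))) * k (1 - s)) =
      cnj (\<phi> (cis (2 * pi * s))) * (2 * \<i> * of_real (sin (2 * pi * s)) * k s)"
      by (simp add: k_def sc)
  qed
  finally have I3: "((\<lambda>s. cnj (\<phi> (cis (2 * pi * s))) * (2 * \<i> * of_real (sin (2 * pi * s)) * k s)) has_integral (\<phi> z - \<phi> 0)) {0..1}" .
  have "((\<lambda>s. (\<phi> (cis (2 * pi * s)) * (- 2 * \<i> * of_real (sin (2 * pi * s)) * k s) +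
              cnj (\<phi> (cis (2 * pi * s))) * (2 * \<i> * of_real (sin (2 * pi * s)) * k s)) / 2) has_integral
          ((\<phi> z - \<phi> 0) + (\<phi> z - \<phi> 0)) / 2) {0..1}"
    by (intro has_integral_divide has_integral_add I2 I3)
  also have "(\<lambda>s. (\<phi> (cis (2 * pi * s)) * (- 2 * \<i> * of_real (sin (2 * pi * s)) * k s) +
              cnj (\<phi> (cis (2 * pi * s))) * (2 * \<i> * of_real (sin (2 * pi * s)) * k s)) / 2) =
      (\<lambda>s. of_real (2 * Im (\<phi> (cis (2 * pi * s))) * sin (2 * pi * s)) * k s)"
  proof
    fix s :: real
    have *: "(w * (- 2 * \<i> * b * c) + cnj w * (2 * \<i> * b * c)) / 2 = of_real (2 * Im w) * b * c" for w b c
    proof -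
      have "(w * (- 2 * \<i> * b * c) + cnj w * (2 * \<i> * b * c)) / 2 = - \<i> * (w - cnj w) * b * c" by (simp add: field_simps)
      also have "- \<i> * (w - cnj w) = of_real (2 * Im w)" by (simp add: complex_eq_iff)
      finally show ?thesis .
    qed
    show "(\<phi> (cis (2 * pi * s)) * (- 2 * \<i> * of_real (sin (2 * pi * s)) * k s) +
              cnj (\<phi> (cis (2 * pi * s))) * (2 * \<i> * of_real (sin (2 * pi * s)) * k s)) / 2 =
      of_real (2 * Im (\<phi> (cis (2 * pi * s))) * sin (2 * pi * s)) * k s"
      unfolding * by simp
  qed
  also have "((\<phi> z - \<phi> 0) + (\<phi> z - \<phi> 0)) / 2 = \<phi> z - \<phi> 0" by simp
  finally show ?thesis unfolding k_def .
qed

lemma weighted_kernel_has_field_derivative: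
  fixes K K1 :: "real \<Rightarrow> complex \<Rightarrow> complex" and m :: "real \<Rightarrow> real"
  assumes m: "continuous_on {0..1} m"
    and K: "continuous_on (ball 0 \<rho> \<times> {0..1}) (\<lambda>(z, s). K s z)"
    and K1: "continuous_on (ball 0 \<rho> \<times> {0..1}) (\<lambda>(z, s). K1 s z)"
    and d: "\<And>s z. s \<in> {0..1} \<Longrightarrow> z \<in> ball 0 \<rho> \<Longrightarrow> (K s has_field_derivative K1 s z) (at z)"
    and z: "z \<in> ball 0 \<rho>"
  shows "((\<lambda>z. integral {0..1} (\<lambda>s. of_real (m s) * K s z)) has_field_derivative
            integral {0..1} (\<lambda>s. of_real (m s) * K1 s z)) (at z)"
proof -
  have "((\<lambda>z. integral (cbox 0 1) (\<lambda>s. of_real (m s) * K s z)) has_field_derivative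
            integral (cbox 0 1) (\<lambda>s. of_real (m s) * K1 s z)) (at z within ball 0 \<rho>)"
  proof (rule leibniz_rule_field_derivative)
    fix z s assume zs: "z \<in> ball (0::complex) \<rho>" "s \<in> cbox (0::real) 1"
    show "((\<lambda>x. of_real (m s) * K s x) has_field_derivative of_real (m s) * K1 s z) (at z within ball 0 \<rho>)"
      using zs by (intro DERIV_cmult DERIV_subset[OF d]) auto
  next
    fix z assume zs: "z \<in> ball (0::complex) \<rho>"
    have "continuous_on {0..1} (\<lambda>s. (\<lambda>(z, s). K s z) (z, s))"
      by (rule continuous_on_compose2[OF K]) (use zs in \<open>auto intro!: continuous_intros\<close>)
    thus "(\<lambda>s. of_real (m s) * K s z) integrable_on cbox 0 1"
      using m by (intro integrable_continuous continuous_intros) auto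
  next
    have "continuous_on (ball 0 \<rho> \<times> {0..1}) (\<lambda>x. of_real (m (snd x)) * (case x of (z, s) \<Rightarrow> K1 s z) :: complex)"
      by (intro continuous_intros K1 continuous_on_compose2[OF m]) auto
    thus "continuous_on (ball 0 \<rho> \<times> cbox 0 1) (\<lambda>(z, s). of_real (m s) * K1 s z)"
      by (simp add: case_prod_unfold)
  qed (use z in auto)
  thus ?thesis using z by (simp add: at_within_open[OF z])
qed

lemma weighted_integral_pos:
  fixes G m :: "real \<Rightarrow> real"
  assumes "continuous_on {0..1} m" "continuous_on {0..1} G"
    and "\<And>s. s \<in> {0..1} \<Longrightarrow> m s \<ge> 0" "\<And>s. s \<in> {0..1} \<Longrightarrow> G s > 0"
    and "s0 \<in> {0..1}" "m s0 > 0"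
  shows "integral {0..1} (\<lambda>s. m s * G s) > 0"
proof -
  have c: "continuous_on {0..1} (\<lambda>s. m s * G s)" using assms by (intro continuous_intros)
  have nn: "m s * G s \<ge> 0" if "s \<in> {0..1}" for s using assms(3,4)[OF that] by simp
  have "m s0 * G s0 \<noteq> 0" using assms(4,5,6) by force
  hence "integral {0..1} (\<lambda>s. m s * G s) \<noteq> 0"
    using integral_eq_0_iff[OF c _ nn] assms(5) by auto
  moreover have "integral {0..1} (\<lambda>s. m s * G s) \<ge> 0"
    by (rule integral_nonneg[OF integrable_continuous_real[OF c] nn])
  ultimately show ?thesis by linarith
qed

lemma weighted_integral_bounded_linear:
  fixes L :: "complex \<Rightarrow> real" and m :: "real \<Rightarrow> real" and g :: "real \<Rightarrow> complex"
  assumes L: "bounded_linear L" and m: "continuous_on {0..1} m" and g: "continuous_on {0..1} g"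
  shows "L (integral {0..1} (\<lambda>s. of_real (m s) * g s)) = integral {0..1} (\<lambda>s. m s * L (g s))"
proof -
  have "(\<lambda>s. of_real (m s) * g s) integrable_on {0..1}"
    by (intro integrable_continuous_real continuous_intros m g)
  from integral_linear[OF this L] show ?thesis
    by (simp add: o_def scaleR_conv_of_real[symmetric] linear_simps(5)[OF L])
qed

text \<open>
  The reduction to kernels.  After the change of variable \<open>\<sigma>\<close> the Koebe-type kernels become \<open>k t\<close>; positivity
  of \<open>Re (k1 t z)\<close> gives injectivity of \<open>\<phi> \<circ> \<sigma>\<close>, and the multiplier condition \<open>crit\<close> gives horizontal convexity
  of the images of all smaller disks.
\<close>

lemma typically_real_pair_inj_on:
  fixes \<phi> \<psi> \<sigma> :: "complex \<Rightarrow> complex" and k k1 k2 :: "real \<Rightarrow> complex \<Rightarrow> complex"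
  assumes R: "R > 1" and hol: "\<phi> holomorphic_on ball 0 R" "\<psi> holomorphic_on ball 0 R"
    and real: "\<And>z. z \<in> ball 0 R \<Longrightarrow> Im z = 0 \<Longrightarrow> Im (\<phi> z) = 0"
    and sign: "\<And>z. z \<in> ball 0 R \<Longrightarrow> Im z \<noteq> 0 \<Longrightarrow> Im z * Im (\<phi> z) > 0"
    and pos: "\<And>z. z \<in> ball 0 R \<Longrightarrow> deriv \<phi> z \<noteq> 0 \<Longrightarrow> Re (deriv \<psi> z / deriv \<phi> z) > 0"
    and \<sigma>: "\<sigma> holomorphic_on ball 0 \<rho>" "\<And>z. z \<in> ball 0 \<rho> \<Longrightarrow> norm (\<sigma> z) < 1"
      "\<And>z. z \<in> ball 0 \<rho> \<Longrightarrow> Im z = 0 \<Longrightarrow> Im (\<sigma> z) = 0"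
      "\<And>z. z \<in> ball 0 \<rho> \<Longrightarrow> Im z \<noteq> 0 \<Longrightarrow> Im z * Im (\<sigma> z) > 0"
    and k: "\<And>t z. t \<in> {-1..1} \<Longrightarrow> z \<in> ball 0 \<rho> \<Longrightarrow> \<sigma> z / (1 - 2 * of_real t * \<sigma> z + (\<sigma> z)\<^sup>2) = k t z"
    and dk: "\<And>t z. t \<in> {-1..1} \<Longrightarrow> z \<in> ball 0 \<rho> \<Longrightarrow> (k t has_field_derivative k1 t z) (at z)"
    and dk1: "\<And>t z. t \<in> {-1..1} \<Longrightarrow> z \<in> ball 0 \<rho> \<Longrightarrow> (k1 t has_field_derivative k2 t z) (at z)"
    and cont: "continuous_on (ball 0 \<rho> \<times> {-1..1}) (\<lambda>(z, t). k t z)"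
      "continuous_on (ball 0 \<rho> \<times> {-1..1}) (\<lambda>(z, t). k1 t z)"
      "continuous_on (ball 0 \<rho> \<times> {-1..1}) (\<lambda>(z, t). k2 t z)"
    and Re_k1: "\<And>t z. t \<in> {-1..1} \<Longrightarrow> z \<in> ball 0 \<rho> \<Longrightarrow> Re (k1 t z) > 0"
    and crit: "\<And>z. z \<in> ball 0 \<rho> \<Longrightarrow> Im z \<noteq> 0 \<Longrightarrow>
        \<exists>l. \<forall>t\<in>{-1..1}. Im z * Im (z * k1 t z + z\<^sup>2 * k2 t z) + l * Re (z * k1 t z) > 0"
  shows "inj_on (\<lambda>z. Complex (Re (\<psi> (\<sigma> z))) (Im (\<phi> (\<sigma> z)))) (ball 0 \<rho>)"
proof -
  define m where "m = (\<lambda>s. 2 * Im (\<phi> (cis (2 * pi * s))) * sin (2 * pi * s))"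
  define c where "c = (\<lambda>s. cos (2 * pi * s))"
  define \<Phi> where "\<Phi> = (\<lambda>z. \<phi> (\<sigma> z))"
  define \<Psi> where "\<Psi> = (\<lambda>z. \<psi> (\<sigma> z))"
  have cI: "c s \<in> {-1..1}" for s by (simp add: c_def)
  have cc: "continuous_on S c" for S unfolding c_def by (intro continuous_intros)
  have cis_in: "cis x \<in> ball 0 R" for x using R by simp
  have cm: "continuous_on {0..1} m"
    unfolding m_def
    by (intro continuous_intros continuous_on_compose2[OF holomorphic_on_imp_continuous_on[OF hol(1)]])
       (use cis_in in auto)
  have m_nn: "m s \<ge> 0" for s
  proof (cases "sin (2 * pi * s) = 0")
    case False
    hence "sin (2 * pi * s) * Im (\<phi> (cis (2 * pi * s))) > 0" using sign[OF cis_in, of "2 * pi * s"] by simp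
    thus ?thesis by (simp add: m_def mult_ac)
  qed (simp add: m_def)
  \<comment> \<open>The weight does not vanish at \<open>\<i>\<close>; this makes all averages strictly positive.\<close>
  have m_pos: "m (1/4) > 0"
    using sign[OF cis_in, of "pi/2"] by (simp add: m_def)
  have KK: "continuous_on (ball 0 \<rho> \<times> {0..1}) (\<lambda>(z, s). q (c s) z)"
    if "continuous_on (ball 0 \<rho> \<times> {-1..1}) (\<lambda>(z, t). q t z)" for q :: "real \<Rightarrow> complex \<Rightarrow> complex"
  proof -
    have "continuous_on (ball 0 \<rho> \<times> {0..1}) (\<lambda>x. (\<lambda>(z, t). q t z) (fst x, c (snd x)))"
      by (rule continuous_on_compose2[OF that])
         (use cI in \<open>auto intro!: continuous_intros continuous_on_compose2[OF cc[of UNIV]] simp del: atLeastAtMost_iff\<close>)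
    thus ?thesis by (simp add: case_prod_unfold)
  qed
  have KS: "continuous_on {0..1} (\<lambda>s. q (c s) z)"
    if "continuous_on (ball 0 \<rho> \<times> {-1..1}) (\<lambda>(z, t). q t z)" "z \<in> ball 0 \<rho>" for q :: "real \<Rightarrow> complex \<Rightarrow> complex" and z
  proof -
    have "continuous_on {0..1} (\<lambda>s. (\<lambda>(z, t). q t z) (z, c s))"
      by (rule continuous_on_compose2[OF that(1)])
         (use cI that(2) in \<open>auto intro!: continuous_intros cc simp del: atLeastAtMost_iff\<close>)
    thus ?thesis by simp
  qed
  define I1 where "I1 = (\<lambda>z. integral {0..1} (\<lambda>s. of_real (m s) * k1 (c s) z))"
  define I2 where "I2 = (\<lambda>z. integral {0..1} (\<lambda>s. of_real (m s) * k2 (c s) z))"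
  have rep: "\<phi> 0 + integral {0..1} (\<lambda>s. of_real (m s) * k (c s) z) = \<Phi> z" if z: "z \<in> ball 0 \<rho>" for z
    using integral_unique[OF typically_real_representation[OF hol(1) R real \<sigma>(2)[OF z]]]
    by (simp add: m_def c_def k[OF cI z, unfolded c_def] \<Phi>_def)
  have d\<Phi>: "(\<Phi> has_field_derivative I1 z) (at z)" if z: "z \<in> ball 0 \<rho>" for z
  proof (rule has_field_derivative_transform_within_open[where S = "ball 0 \<rho>"])
    show "((\<lambda>z. \<phi> 0 + integral {0..1} (\<lambda>s. of_real (m s) * k (c s) z)) has_field_derivative I1 z) (at z)"
      unfolding I1_def
      by (rule DERIV_add[OF DERIV_const, simplified], rule weighted_kernel_has_field_derivative[OF cm KK[OF cont(1)] KK[OF cont(2)] _ z])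
         (use dk cI in auto)
  qed (use z rep in auto)
  have der\<Phi>: "deriv \<Phi> z = I1 z" if "z \<in> ball 0 \<rho>" for z using d\<Phi>[OF that] by (rule DERIV_imp_deriv)
  have dd\<Phi>: "(deriv \<Phi> has_field_derivative I2 z) (at z)" if z: "z \<in> ball 0 \<rho>" for z
  proof (rule has_field_derivative_transform_within_open[where S = "ball 0 \<rho>"])
    show "(I1 has_field_derivative I2 z) (at z)"
      unfolding I1_def I2_def
      by (rule weighted_kernel_has_field_derivative[OF cm KK[OF cont(2)] KK[OF cont(3)] _ z]) (use dk1 cI in auto)
  qed (use z der\<Phi> in auto)
  have der2\<Phi>: "deriv (deriv \<Phi>) z = I2 z" if "z \<in> ball 0 \<rho>" for z using dd\<Phi>[OF that] by (rule DERIV_imp_deriv)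
  have hol\<Phi>: "\<Phi> holomorphic_on ball 0 \<rho>"
    using d\<Phi> unfolding holomorphic_on_open[OF open_ball] by blast
  have img: "\<sigma> ` ball 0 \<rho> \<subseteq> ball 0 R" using \<sigma>(2) R by (force simp: dist_norm)
  have hol\<Psi>: "\<Psi> holomorphic_on ball 0 \<rho>"
    using holomorphic_on_compose_gen[OF \<sigma>(1) hol(2) img] by (simp add: \<Psi>_def o_def)
  have Re_pos: "Re (deriv \<Phi> z) > 0" if z: "z \<in> ball 0 \<rho>" for z
  proof -
    have "Re (I1 z) = integral {0..1} (\<lambda>s. m s * Re (k1 (c s) z))"
      unfolding I1_def by (rule weighted_integral_bounded_linear[OF bounded_linear_Re cm KS[OF cont(2) z]])
    also have "\<dots> > 0"
      by (rule weighted_integral_pos[OF cm _ m_nn _ _ m_pos])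
         (use Re_k1[OF cI z] KS[OF cont(2) z] in \<open>auto intro!: continuous_intros\<close>)
    finally show ?thesis using der\<Phi>[OF z] by simp
  qed
  have crit\<Phi>: "Im z * Im (z * deriv \<Phi> z + z\<^sup>2 * deriv (deriv \<Phi>) z) > 0"
    if z: "z \<in> ball 0 \<rho>" "Im z \<noteq> 0" "Re (z * deriv \<Phi> z) = 0" for z
  proof -
    obtain l where l: "\<And>t. t \<in> {-1..1} \<Longrightarrow> Im z * Im (z * k1 t z + z\<^sup>2 * k2 t z) + l * Re (z * k1 t z) > 0"
      using crit[OF z(1,2)] by blast
    define L1 where "L1 = (\<lambda>w. Im z * Im (z * w) + l * Re (z * w))"
    define L2 where "L2 = (\<lambda>w. Im z * Im (z\<^sup>2 * w))"
    have b1: "bounded_linear L1" unfolding L1_def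
      by (intro bounded_linear_add bounded_linear_const_mult bounded_linear_compose[OF bounded_linear_Im]
             bounded_linear_compose[OF bounded_linear_Re] bounded_linear_mult_right)
    have b2: "bounded_linear L2" unfolding L2_def
      by (intro bounded_linear_const_mult bounded_linear_compose[OF bounded_linear_Im] bounded_linear_mult_right)
    note c1 = KS[OF cont(2) z(1)] and c2 = KS[OF cont(3) z(1)]
    have cL: "continuous_on {0..1} (\<lambda>s. L1 (k1 (c s) z))" "continuous_on {0..1} (\<lambda>s. L2 (k2 (c s) z))"
      by (intro bounded_linear.continuous_on[OF b1] bounded_linear.continuous_on[OF b2] c1 c2)+
    have "L1 (I1 z) + L2 (I2 z) = integral {0..1} (\<lambda>s. m s * L1 (k1 (c s) z)) + integral {0..1} (\<lambda>s. m s * L2 (k2 (c s) z))"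
      unfolding I1_def I2_def
      by (simp add: weighted_integral_bounded_linear[OF b1 cm c1] weighted_integral_bounded_linear[OF b2 cm c2])
    also have "\<dots> = integral {0..1} (\<lambda>s. m s * L1 (k1 (c s) z) + m s * L2 (k2 (c s) z))"
      by (rule integral_add[symmetric]) (intro integrable_continuous_real continuous_on_mult cm cL)+
    also have "\<dots> = integral {0..1} (\<lambda>s. m s * (L1 (k1 (c s) z) + L2 (k2 (c s) z)))"
      by (simp add: distrib_left)
    also have "\<dots> > 0"
    proof (rule weighted_integral_pos[OF cm _ m_nn _ _ m_pos])
      fix s show "L1 (k1 (c s) z) + L2 (k2 (c s) z) > 0"
        using l[OF cI[of s]] by (simp only: L1_def L2_def plus_complex.simps distrib_left; argo)
    qed (auto intro: continuous_on_add cL)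
    finally show ?thesis
      using z(3) unfolding der2\<Phi>[OF z(1)] der\<Phi>[OF z(1)] by (simp only: L1_def L2_def plus_complex.simps distrib_left; argo)
  qed
  have pos\<Phi>: "Re (deriv \<Psi> z / deriv \<Phi> z) > 0" if z: "z \<in> ball 0 \<rho>" for z
  proof -
    have sR: "\<sigma> z \<in> ball 0 R" using img z by blast
    have d: "(\<sigma> has_field_derivative deriv \<sigma> z) (at z)" "(\<phi> has_field_derivative deriv \<phi> (\<sigma> z)) (at (\<sigma> z))"
            "(\<psi> has_field_derivative deriv \<psi> (\<sigma> z)) (at (\<sigma> z))"
      using holomorphic_derivI[OF \<sigma>(1) _ z] holomorphic_derivI[OF hol(1) _ sR] holomorphic_derivI[OF hol(2) _ sR] by auto
    have "deriv \<Phi> z = deriv \<phi> (\<sigma> z) * deriv \<sigma> z" "deriv \<Psi> z = deriv \<psi> (\<sigma> z) * deriv \<sigma> z"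
      unfolding \<Phi>_def \<Psi>_def by (rule DERIV_imp_deriv, rule DERIV_chain2, rule d, rule d)+
    moreover have "deriv \<Phi> z \<noteq> 0" using Re_pos[OF z] by auto
    ultimately show ?thesis using pos[OF sR] by simp
  qed
  have real\<Phi>: "Im (\<Phi> z) = 0" if "z \<in> ball 0 \<rho>" "Im z = 0" for z
    using real[of "\<sigma> z"] \<sigma>(3)[OF that] img that unfolding \<Phi>_def by blast
  have sign\<Phi>: "Im z * Im (\<Phi> z) > 0" if z: "z \<in> ball 0 \<rho>" "Im z \<noteq> 0" for z
  proof -
    have "Im z * Im (\<sigma> z) > 0" by (rule \<sigma>(4)[OF z])
    moreover from this have "Im (\<sigma> z) * Im (\<phi> (\<sigma> z)) > 0" using sign[of "\<sigma> z"] img z by fastforce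
    ultimately show ?thesis by (auto simp: \<Phi>_def zero_less_mult_iff)
  qed
  have inj\<Phi>: "inj_on \<Phi> (ball 0 \<rho>)"
    by (rule inj_on_if_Re_deriv_pos[OF hol\<Phi> _ _ Re_pos]) auto
  have inj_r: "inj_on (\<lambda>z. Complex (Re (\<Psi> z)) (Im (\<Phi> z))) (ball 0 r)" if r: "0 < r" "r < \<rho>" for r
  proof (rule shear_inj_on)
    have sub: "ball 0 r \<subseteq> ball (0::complex) \<rho>" using r by auto
    show "\<Phi> holomorphic_on ball 0 r" "\<Psi> holomorphic_on ball 0 r"
      using hol\<Phi> hol\<Psi> sub holomorphic_on_subset by blast+
    show injr: "inj_on \<Phi> (ball 0 r)" using inj\<Phi> sub inj_on_subset by blast
    show "Re (deriv \<Psi> z / deriv \<Phi> z) > 0" if "z \<in> ball 0 r" for z using pos\<Phi> that sub by blast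
    fix a b assume ab: "a \<in> ball (0::complex) r" "b \<in> ball 0 r" "Im (\<Phi> a) = Im (\<Phi> b)"
    show "closed_segment (\<Phi> a) (\<Phi> b) \<subseteq> \<Phi> ` ball 0 r"
    proof (rule horizontally_convex_image[OF hol\<Phi> r injr _ ab])
      fix z1 z2 z3 assume *: "norm z1 = r" "norm z2 = r" "norm z3 = r" "z1 \<noteq> z2" "z2 \<noteq> z3" "z1 \<noteq> z3"
        "Im (\<Phi> z1) = Im (\<Phi> z2)" "Im (\<Phi> z2) = Im (\<Phi> z3)"
      show False
      proof (rule circle_Im_no_three_equal_values[OF hol\<Phi> r _ _ _ *(1-3) _ _ refl *(4-6)])
        show "Im z * Im (z * deriv \<Phi> z + z\<^sup>2 * deriv (deriv \<Phi>) z) > 0"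
          if "norm z = r" "Im z \<noteq> 0" "Re (z * deriv \<Phi> z) = 0" for z
          by (rule crit\<Phi>) (use that r in auto)
      qed (use real\<Phi> sign\<Phi> * in auto)
    qed
  qed auto
  show ?thesis
  proof (rule inj_onI)
    fix a b assume ab: "a \<in> ball 0 \<rho>" "b \<in> ball 0 \<rho>" and
      eq: "Complex (Re (\<psi> (\<sigma> a))) (Im (\<phi> (\<sigma> a))) = Complex (Re (\<psi> (\<sigma> b))) (Im (\<phi> (\<sigma> b)))"
    define r where "r = (max (norm a) (norm b) + \<rho>) / 2"
    have r: "0 < r" "r < \<rho>" "norm a < r" "norm b < r" using ab by (auto simp: r_def max_def intro: add_nonneg_pos le_less_trans[OF norm_ge_zero])
    show "a = b" using inj_onD[OF inj_r[OF r(1,2)], of a b] eq r by (simp add: \<Phi>_def \<Psi>_def)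
  qed
qed

section \<open>The two families of kernels\<close>

lemma polar_coordinates:
  fixes z :: complex
  assumes "z \<noteq> 0"
  obtains x y where "z = of_real (norm z) * Complex x y" "x\<^sup>2 + y\<^sup>2 = 1" "Im z = norm z * y"
proof
  show "z = of_real (norm z) * Complex (Re z / norm z) (Im z / norm z)" using assms by (simp add: complex_eq_iff)
  show "(Re z / norm z)\<^sup>2 + (Im z / norm z)\<^sup>2 = 1"
    using assms by (auto simp: power_divide cmod_power2 add_divide_distrib[symmetric] complex_eq_iff)
qed (use assms in \<open>auto simp: complex_eq_iff\<close>)

lemma koebe_denominator_eq:
  fixes z :: complex
  assumes "z \<noteq> 0"
  shows "1 - 2 * of_real t * z + z\<^sup>2 = z * (1 / z + z - of_real (2 * t))"
  using assms by (simp add: field_simps power2_eq_square)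

text \<open>
  With \<open>w = 1/z + z\<close> the kernel is \<open>K = 1/(w - 2t)\<close>, so \<open>zK' = (1/z - z)/(w - 2t)\<^sup>2\<close> and
  \<open>z(zK')' = (w\<^sup>2 + 2tw - 8)/(w - 2t)\<^sup>3\<close>.  Multiplying by powers of the conjugate of \<open>w - 2t\<close> turns both into
  polynomials in \<open>x\<close>, \<open>y\<close>, \<open>t\<close>, \<open>A\<close> and \<open>B\<close> over powers of the positive number \<open>P = \<bar>w - 2t\<bar>\<^sup>2\<close>.
\<close>

lemma koebe_kernel_critical:
  fixes z :: complex
  assumes z: "norm z < sqrt 6 - sqrt 5" "Im z \<noteq> 0"
  shows "\<exists>l. \<forall>t\<in>{-1..1}.
     Im z * Im (z * ((1 - z\<^sup>2) / (1 - 2 * of_real t * z + z\<^sup>2)\<^sup>2)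
        + z\<^sup>2 * ((- 2 * z * (1 - 2 * of_real t * z + z\<^sup>2) - 2 * (1 - z\<^sup>2) * (2 * z - 2 * of_real t)) / (1 - 2 * of_real t * z + z\<^sup>2)^3))
     + l * Re (z * ((1 - z\<^sup>2) / (1 - 2 * of_real t * z + z\<^sup>2)\<^sup>2)) > 0"
proof -
  define r where "r = norm z"
  have z0: "z \<noteq> 0" using z by auto
  have r: "0 < r" "r < sqrt 6 - sqrt 5" using z0 z by (auto simp: r_def)
  obtain x y where xy: "z = of_real r * Complex x y" "x\<^sup>2 + y\<^sup>2 = 1" "Im z = r * y"
    using polar_coordinates[OF z0] unfolding r_def by metis
  have y0: "y \<noteq> 0" using xy z by auto
  define A B where "A = 1 / r + r" and "B = 1 / r - r"
  have AB: "B\<^sup>2 = A\<^sup>2 - 4" using r by (simp add: A_def B_def power2_eq_square field_simps)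
  have r1: "r < 1"
  proof -
    have "sqrt 6 < 3" "sqrt 5 > 2" by (auto intro: real_less_lsqrt real_less_rsqrt)
    thus ?thesis using r by linarith
  qed
  have Bpos: "B > 0" using r r1 by (simp add: B_def field_simps) (metis mult_strict_mono mult_1 less_imp_le zero_less_one order.strict_trans)
  have A24: "A\<^sup>2 > 24"
  proof -
    have "(sqrt 6 - r)\<^sup>2 > (sqrt 5)\<^sup>2" using r by (intro power_strict_mono) auto
    hence "r\<^sup>2 + 1 > 2 * sqrt 6 * r" by (simp add: power2_eq_square algebra_simps)
    hence "A > 2 * sqrt 6" using r by (simp add: A_def field_simps power2_eq_square)
    hence "A\<^sup>2 > (2 * sqrt 6)\<^sup>2" by (intro power_strict_mono) auto
    thus ?thesis by (simp add: power_mult_distrib)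
  qed
  define w where "w = 1 / z + z"
  have inv: "1 / z = Complex (x / r) (- y / r)"
  proof -
    have "z * Complex (x / r) (- y / r) = 1"
      using r xy(2) by (subst xy(1)) (simp add: complex_eq_iff power2_eq_square)
    thus ?thesis using z0 by (simp add: field_simps)
  qed
  have w_eq: "w = Complex (A * x) (- (B * y))"
    unfolding w_def inv by (subst xy(1)) (simp add: complex_eq_iff A_def B_def algebra_simps)
  have iz_eq: "1 / z - z = Complex (B * x) (- (A * y))"
    unfolding inv by (subst xy(1)) (simp add: complex_eq_iff A_def B_def algebra_simps)
  define D where "D = A\<^sup>2 * (1 + x\<^sup>2) + 12 * x\<^sup>2 - 4 * x^4"
  have D: "D > 0"
  proof -
    have "x\<^sup>2 \<le> 1" using xy(2) zero_le_power2[of y] by linarith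
    hence "x\<^sup>2 * x\<^sup>2 \<le> x\<^sup>2" by (intro mult_left_le) auto
    moreover have "x^4 = x\<^sup>2 * x\<^sup>2" by (simp add: power4_eq_xxxx power2_eq_square)
    ultimately have "x^4 \<le> x\<^sup>2" by (metis (no_types))
    moreover have "A\<^sup>2 * (1 + x\<^sup>2) > 0"
    proof (rule mult_pos_pos)
      show "A\<^sup>2 > 0" using A24 by linarith
      show "1 + x\<^sup>2 > 0" by (intro add_pos_nonneg) simp_all
    qed
    moreover have "x\<^sup>2 \<ge> 0" by simp
    ultimately show ?thesis unfolding D_def by linarith
  qed
  define l where "l = r * y\<^sup>2 * (A\<^sup>2 + 24 + 4 * x\<^sup>2) * x / D"
  show ?thesis
  proof (intro exI[of _ l] ballI)
    fix t :: real assume t: "t \<in> {-1..1}"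
    define u where "u = A * x - 2 * t"
    define X where "X = Complex u (B * y)"
    define P where "P = u\<^sup>2 + B\<^sup>2 * y\<^sup>2"
    define v where "v = w - of_real (2 * t)"
    have P: "P > 0" using Bpos y0 by (auto simp: P_def intro!: add_nonneg_pos)
    have vX: "v * X = of_real P"
      by (simp add: v_def X_def w_eq P_def u_def complex_eq_iff power2_eq_square algebra_simps)
    have v0: "v \<noteq> 0" using vX P by auto
    have iv: "inverse v = X / of_real P" using vX P v0 by (simp add: field_simps)
    define E0 where "E0 = (A\<^sup>2 * x\<^sup>2 - (A\<^sup>2 - 4) * y\<^sup>2 + (2 * t) * A * x - 8) * (3 * (A * x - 2 * t)\<^sup>2 - (A\<^sup>2 - 4) * y\<^sup>2)
            - (2 * A * x + 2 * t) * ((A * x - 2 * t)^3 - 3 * (A * x - 2 * t) * ((A\<^sup>2 - 4) * y\<^sup>2))"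
    define G0 where "G0 = x * ((A * x - 2 * t)\<^sup>2 - (A\<^sup>2 - 4) * y\<^sup>2) + 2 * A * y\<^sup>2 * (A * x - 2 * t)"
    have den: "1 - 2 * of_real t * z + z\<^sup>2 = z * v"
      unfolding v_def w_def by (rule koebe_denominator_eq[OF z0])
    have zz: "z * (1 / z) = 1" using z0 by simp
    have d_eq: "z * ((1 - z\<^sup>2) / (z * v)\<^sup>2) = (1 / z - z) / v\<^sup>2"
      using z0 v0 by (simp add: field_simps power2_eq_square)
    have n_eq: "z * ((1 - z\<^sup>2) / (z * v)\<^sup>2) + z\<^sup>2 * ((- 2 * z * (z * v) - 2 * (1 - z\<^sup>2) * (2 * z - 2 * of_real t)) / (z * v)^3)
        = (w\<^sup>2 + of_real (2 * t) * w - 8) / v^3"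
    proof -
      have zw: "z * w = 1 + z\<^sup>2" using zz by (simp add: w_def algebra_simps power2_eq_square)
      have "z * ((1 - z\<^sup>2) / (z * v)\<^sup>2) + z\<^sup>2 * ((- 2 * z * (z * v) - 2 * (1 - z\<^sup>2) * (2 * z - 2 * of_real t)) / (z * v)^3)
        = ((1 - z\<^sup>2) * v * z - 2 * z\<^sup>2 * (z * v) - 2 * z * (1 - z\<^sup>2) * (2 * z - 2 * of_real t)) / (z\<^sup>2 * v^3)"
        using z0 v0 by (simp add: divide_simps) algebra
      also have "(1 - z\<^sup>2) * v * z - 2 * z\<^sup>2 * (z * v) - 2 * z * (1 - z\<^sup>2) * (2 * z - 2 * of_real t)
                 = z\<^sup>2 * (w\<^sup>2 + of_real (2 * t) * w - 8)"
        using zw unfolding v_def of_real_mult of_real_numeral by algebra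
      finally show ?thesis using z0 by simp
    qed
    have "Re ((1 / z - z) * X\<^sup>2) = B * G0"
      unfolding iz_eq X_def u_def G0_def AB[symmetric] by (simp add: power2_eq_square) algebra
    moreover have "(1 / z - z) / v\<^sup>2 = (1 / z - z) * X\<^sup>2 / of_real (P\<^sup>2)"
      by (simp add: divide_inverse[of _ "v\<^sup>2"] power_inverse[symmetric] iv power_divide)
    ultimately have d: "Re ((1 / z - z) / v\<^sup>2) = B * G0 / P\<^sup>2" by (simp only: Re_divide_of_real)
    have "Im ((w\<^sup>2 + of_real (2 * t) * w - 8) * X^3) = B * y * E0"
      unfolding w_eq X_def u_def E0_def AB[symmetric] by (simp add: power2_eq_square power3_eq_cube) algebra
    moreover have "(w\<^sup>2 + of_real (2 * t) * w - 8) / v^3 = (w\<^sup>2 + of_real (2 * t) * w - 8) * X^3 / of_real (P^3)"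
      by (simp add: divide_inverse[of _ "v^3"] power_inverse[symmetric] iv power_divide)
    ultimately have n: "Im ((w\<^sup>2 + of_real (2 * t) * w - 8) / v^3) = B * y * E0 / P^3" by (simp only: Im_divide_of_real)
    have "D * E0 + (A\<^sup>2 + 24 + 4 * x\<^sup>2) * x * (G0 * P) > 0"
      using koebe_kernel_poly_pos[OF xy(2) A24, of "2 * t"] t
      unfolding D_def E0_def G0_def P_def u_def AB by (simp add: abs_le_iff)
    hence "r * y\<^sup>2 * B / (D * P^3) * (D * E0 + (A\<^sup>2 + 24 + 4 * x\<^sup>2) * x * (G0 * P)) > 0"
      using r y0 Bpos D P by (intro mult_pos_pos divide_pos_pos) auto
    also have "r * y\<^sup>2 * B / (D * P^3) * (D * E0 + (A\<^sup>2 + 24 + 4 * x\<^sup>2) * x * (G0 * P))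
       = r * y * (B * y * E0 / P^3) + l * (B * G0 / P\<^sup>2)"
      using D P by (simp add: l_def field_simps power2_eq_square power3_eq_cube)
    finally show "Im z * Im (z * ((1 - z\<^sup>2) / (1 - 2 * of_real t * z + z\<^sup>2)\<^sup>2)
        + z\<^sup>2 * ((- 2 * z * (1 - 2 * of_real t * z + z\<^sup>2) - 2 * (1 - z\<^sup>2) * (2 * z - 2 * of_real t)) / (1 - 2 * of_real t * z + z\<^sup>2)^3))
     + l * Re (z * ((1 - z\<^sup>2) / (1 - 2 * of_real t * z + z\<^sup>2)\<^sup>2)) > 0"
      unfolding den n_eq n unfolding d_eq d xy(3) .
  qed
qed

text \<open>
  The same computation for the kernel \<open>z/(2(1 - tz))\<close>, with \<open>a = t\<bar>z\<bar>\<close> and \<open>P = \<bar>1 - tz\<bar>\<^sup>2\<close>.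
\<close>

lemma geometric_kernel_critical:
  fixes z :: complex
  assumes z: "norm z < sqrt 2 - 1" "Im z \<noteq> 0"
  shows "\<exists>l. \<forall>t\<in>{-1..1}.
     Im z * Im (z * (1 / (2 * (1 - of_real t * z)\<^sup>2)) + z\<^sup>2 * (of_real t / (1 - of_real t * z)^3))
     + l * Re (z * (1 / (2 * (1 - of_real t * z)\<^sup>2))) > 0"
proof -
  define r where "r = norm z"
  have z0: "z \<noteq> 0" using z by auto
  have r: "0 < r" "r < sqrt 2 - 1" using z0 z by (auto simp: r_def)
  obtain x y where xy: "z = of_real r * Complex x y" "x\<^sup>2 + y\<^sup>2 = 1" "Im z = r * y"
    using polar_coordinates[OF z0] unfolding r_def by metis
  have y0: "y \<noteq> 0" using xy z by auto
  define l where "l = r * y\<^sup>2 * x / (1 + x\<^sup>2)"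
  have x1: "1 + x\<^sup>2 > 0" by (intro add_pos_nonneg) auto
  show ?thesis
  proof (intro exI[of _ l] ballI)
    fix t :: real assume t: "t \<in> {-1..1}"
    define a where "a = t * r"
    have a: "\<bar>a\<bar> < sqrt 2 - 1"
    proof -
      have "\<bar>a\<bar> \<le> r" using t r by (simp add: a_def abs_mult abs_le_iff mult_left_le_one_le)
      thus ?thesis using r by linarith
    qed
    define X where "X = Complex (1 - a * x) (a * y)"
    define v where "v = 1 - of_real t * z"
    define P where "P = 1 - 2 * a * x + a\<^sup>2"
    have y2: "y\<^sup>2 = 1 - x\<^sup>2" using xy(2) by simp
    have v_eq: "v = Complex (1 - a * x) (- (a * y))"
      unfolding v_def by (subst xy(1)) (simp add: complex_eq_iff a_def)
    have P_eq: "P = (1 - a * x)\<^sup>2 + (a * y)\<^sup>2"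
      unfolding P_def power_mult_distrib y2 by (simp add: power2_eq_square algebra_simps)
    have vX: "v * X = of_real P"
      unfolding P_eq by (simp add: v_eq X_def complex_eq_iff power2_eq_square)
    have P: "P > 0"
    proof (cases "a = 0")
      case False
      thus ?thesis using y0 unfolding P_eq by (intro add_nonneg_pos) auto
    qed (simp add: P_def)
    have v0: "v \<noteq> 0" using vX P by auto
    have iv: "inverse v = X / of_real P" using vX P v0 by (simp add: field_simps)
    define N0 where "N0 = (1 - a\<^sup>2)\<^sup>2 + 2 * a * ((1 + a\<^sup>2) * x - 2 * a)"
    define M0 where "M0 = (1 + a\<^sup>2) * x - 2 * a"
    have d_eq: "z * (1 / (2 * v\<^sup>2)) = z * X\<^sup>2 / of_real (2 * P\<^sup>2)"
      using v0 P by (simp add: field_simps) (metis (no_types, opaque_lifting) vX mult.commute power_mult_distrib of_real_power)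
    have n_eq: "z * (1 / (2 * v\<^sup>2)) + z\<^sup>2 * (of_real t / v^3) = z * (1 + of_real t * z) * X^3 / of_real (2 * P^3)"
    proof -
      have "z * (1 / (2 * v\<^sup>2)) + z\<^sup>2 * (of_real t / v^3) = z * (1 + of_real t * z) / (2 * v^3)"
        using v0 by (simp add: divide_simps) (simp add: v_def, algebra)
      also have "\<dots> = z * (1 + of_real t * z) * X^3 / of_real (2 * P^3)"
        by (simp add: divide_inverse[of _ "2 * v^3"] power_inverse[symmetric] iv power_divide)
      finally show ?thesis .
    qed
    have "Re (z * X\<^sup>2) = r * M0"
    proof -
      have "Re (z * X\<^sup>2) = r * (x * ((1 - a * x)\<^sup>2 - (a * y)\<^sup>2) - y * (2 * (1 - a * x) * (a * y)))"
        unfolding X_def by (subst xy(1)) (simp add: power2_eq_square algebra_simps)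
      also have "x * ((1 - a * x)\<^sup>2 - (a * y)\<^sup>2) - y * (2 * (1 - a * x) * (a * y)) = M0"
        unfolding M0_def using y2 by algebra
      finally show ?thesis .
    qed
    hence d: "Re (z * X\<^sup>2 / of_real (2 * P\<^sup>2)) = r * M0 / (2 * P\<^sup>2)" by (simp only: Re_divide_of_real)
    have "Im (z * (1 + of_real t * z) * X^3) = r * y * N0"
    proof -
      have "1 + of_real t * z = Complex (1 + a * x) (a * y)"
        by (subst xy(1)) (simp add: complex_eq_iff a_def)
      hence "Im (z * (1 + of_real t * z) * X^3) = r * Im (Complex x y * Complex (1 + a * x) (a * y) * (Complex (1 - a * x) (a * y))^3)"
        unfolding X_def by (subst xy(1)) (simp add: algebra_simps)
      also have "Im (Complex x y * Complex (1 + a * x) (a * y) * (Complex (1 - a * x) (a * y))^3) = y * N0"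
        unfolding N0_def using y2 by (simp add: power3_eq_cube) algebra
      finally show ?thesis by simp
    qed
    hence n: "Im (z * (1 + of_real t * z) * X^3 / of_real (2 * P^3)) = r * y * N0 / (2 * P^3)" by (simp only: Im_divide_of_real)
    have "(1 + x\<^sup>2) * N0 + x * (M0 * P) > 0"
      using geometric_kernel_poly_pos[OF xy(2) a] unfolding N0_def M0_def P_def .
    hence "r\<^sup>2 * y\<^sup>2 / (2 * (1 + x\<^sup>2) * P^3) * ((1 + x\<^sup>2) * N0 + x * (M0 * P)) > 0"
      using r y0 x1 P by (intro mult_pos_pos divide_pos_pos) auto
    also have "r\<^sup>2 * y\<^sup>2 / (2 * (1 + x\<^sup>2) * P^3) * ((1 + x\<^sup>2) * N0 + x * (M0 * P))
       = r * y * (r * y * N0 / (2 * P^3)) + l * (r * M0 / (2 * P\<^sup>2))"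
    proof -
      have "r\<^sup>2 * y\<^sup>2 / (2 * Q * P^3) * (Q * N0 + x * (M0 * P))
       = r * y * (r * y * N0 / (2 * P^3)) + (r * y\<^sup>2 * x / Q) * (r * M0 / (2 * P\<^sup>2))" if "Q > 0" for Q
        using that P by (simp add: field_simps power2_eq_square power3_eq_cube)
      from this[OF x1] show ?thesis unfolding l_def .
    qed
    finally show "Im z * Im (z * (1 / (2 * (1 - of_real t * z)\<^sup>2)) + z\<^sup>2 * (of_real t / (1 - of_real t * z)^3))
     + l * Re (z * (1 / (2 * (1 - of_real t * z)\<^sup>2))) > 0"
      unfolding v_def[symmetric] n_eq n unfolding d_eq d xy(3) .
  qed
qed

lemma Re_cayley_pos:
  fixes a b :: complex
  assumes "norm b < norm a"
  shows "Re ((a + b) / (a - b)) > 0"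
proof -
  have ne: "a - b \<noteq> 0" using assms by auto
  have "Re ((a + b) * cnj (a - b)) = (norm a)\<^sup>2 - (norm b)\<^sup>2"
    by (simp add: cmod_power2) algebra
  also have "\<dots> > 0" using assms by (simp add: power_strict_mono)
  finally have "Re ((a + b) * cnj (a - b)) / (norm (a - b))\<^sup>2 > 0" using ne by simp
  thus ?thesis by (simp only: complex_div_cnj[of "a + b" "a - b"] Re_divide_of_real of_real_power[symmetric])
qed

lemma koebe_numerator_small:
  fixes z :: complex
  assumes z: "norm z < 11/50" and t: "\<bar>t\<bar> \<le> 1"
  shows "norm (2 * of_real t * z - z\<^sup>2) < 1/2"
proof -
  have "norm (2 * of_real t * z - z\<^sup>2) \<le> 2 * \<bar>t\<bar> * norm z + (norm z)\<^sup>2"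
    using norm_triangle_ineq4[of "2 * of_real t * z" "z\<^sup>2"] by (simp add: norm_mult norm_power)
  also have "\<bar>t\<bar> * norm z \<le> norm z" using t by (simp add: mult_left_le_one_le)
  hence "2 * \<bar>t\<bar> * norm z + (norm z)\<^sup>2 \<le> 2 * norm z + norm z * norm z" by (simp add: power2_eq_square)
  also have "norm z * norm z \<le> norm z * (11/50)" using z by (intro mult_left_mono) auto
  finally show ?thesis using z by linarith
qed

lemma koebe_denominator_nonzero:
  fixes z :: complex
  assumes "norm z < 11/50" and "\<bar>t\<bar> \<le> 1"
  shows "1 - 2 * of_real t * z + z\<^sup>2 \<noteq> 0"
proof
  assume "1 - 2 * of_real t * z + z\<^sup>2 = 0"
  hence "2 * of_real t * z - z\<^sup>2 = 1" by (simp add: algebra_simps)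
  thus False using koebe_numerator_small[OF assms] by simp
qed

text \<open>
  In this disk \<open>1 - 2tz + z\<^sup>2 = 1 - p\<close> with \<open>\<bar>p\<bar> < 1/2\<close>, which keeps the square of the conjugate of \<open>1 - p\<close> in
  the half plane \<open>Re \<ge> 1/4\<close>; the factor \<open>1 - z\<^sup>2\<close> is too close to 1 to spoil this.
\<close>

lemma koebe_kernel_Re_deriv_pos:
  fixes z :: complex
  assumes z: "norm z < 11/50" and t: "\<bar>t\<bar> \<le> 1"
  shows "Re ((1 - z\<^sup>2) / (1 - 2 * of_real t * z + z\<^sup>2)\<^sup>2) > 0"
proof -
  define p where "p = 2 * of_real t * z - z\<^sup>2"
  define S where "S = (cnj (1 - p))\<^sup>2"
  have p: "norm p < 1/2" unfolding p_def by (rule koebe_numerator_small[OF z t])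
  have q: "1 - 2 * of_real t * z + z\<^sup>2 = 1 - p" by (simp add: p_def)
  have q0: "1 - p \<noteq> 0" using koebe_denominator_nonzero[OF z t] q by simp
  have "(norm p)\<^sup>2 \<le> (1/2)\<^sup>2" using p by (intro power_mono) auto
  hence "(Re p)\<^sup>2 + (Im p)\<^sup>2 \<le> (1/2)\<^sup>2" by (simp only: cmod_power2)
  moreover have "(1/2::real)\<^sup>2 = 1/4" by (simp add: power2_eq_square)
  moreover have "Re S = (1 - Re p)\<^sup>2 - (Im p)\<^sup>2" unfolding S_def Re_power2 by simp
  moreover have "(1 - Re p)\<^sup>2 = 1 - 2 * Re p + (Re p)\<^sup>2" by (simp add: power2_eq_square algebra_simps)
  \<comment> \<open>\<open>(1 - Re p)\<^sup>2 - (Im p)\<^sup>2 \<ge> 1 - 2 Re p + 2 (Re p)\<^sup>2 - 1/4 = 2 (Re p - 1/2)\<^sup>2 + 1/4\<close>\<close>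
  moreover have "(Re p - 1/2)\<^sup>2 = (Re p)\<^sup>2 - Re p + 1/4" by (simp add: power2_eq_square algebra_simps)
  moreover have "(Re p - 1/2)\<^sup>2 \<ge> 0" by simp
  ultimately have ReS: "Re S \<ge> 1/4" by linarith
  have "norm (1 - p) \<le> 3/2" using norm_triangle_ineq4[of 1 p] p by simp
  hence "(norm (1 - p))\<^sup>2 \<le> (3/2)\<^sup>2" by (intro power_mono) auto
  hence nS: "norm S \<le> 9/4" unfolding S_def norm_power complex_mod_cnj by (simp add: power2_eq_square)
  have "(norm z)\<^sup>2 \<le> (11/50)\<^sup>2" using z by (intro power_mono) auto
  hence "norm (z\<^sup>2 * S) \<le> (11/50)\<^sup>2 * (9/4)" unfolding norm_mult norm_power by (intro mult_mono nS) auto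
  hence "Re (z\<^sup>2 * S) \<le> (11/50)\<^sup>2 * (9/4)" using complex_Re_le_cmod order_trans by blast
  hence "Re (z\<^sup>2 * S) < 1/4" by (simp add: power2_eq_square)
  hence pos: "Re ((1 - z\<^sup>2) * S) > 0" using ReS by (simp only: left_diff_distrib mult_1 minus_complex.simps)
  have "(1 - z\<^sup>2) / (1 - p)\<^sup>2 = (1 - z\<^sup>2) * S / of_real ((norm ((1 - p)\<^sup>2))\<^sup>2)"
    by (subst complex_div_cnj) (simp add: S_def)
  hence "Re ((1 - z\<^sup>2) / (1 - p)\<^sup>2) = Re ((1 - z\<^sup>2) * S) / (norm ((1 - p)\<^sup>2))\<^sup>2" by (simp only: Re_divide_of_real)
  also have "\<dots> > 0" using pos q0 by (intro divide_pos_pos) auto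
  finally show ?thesis unfolding q .
qed

lemma sqrt6_minus_sqrt5_less: "sqrt 6 - sqrt 5 < 11/50"
proof -
  have "sqrt 6 < 49/20" by (intro real_less_lsqrt) (auto simp: power2_eq_square)
  moreover have "sqrt 5 > 447/200" by (intro real_less_rsqrt) (auto simp: power2_eq_square)
  ultimately show ?thesis by simp
qed

lemma typically_real_pair_inj_on_disc:
  fixes \<phi> \<psi> :: "complex \<Rightarrow> complex"
  assumes R: "R > 1" and hol: "\<phi> holomorphic_on ball 0 R" "\<psi> holomorphic_on ball 0 R"
    and real: "\<And>z. z \<in> ball 0 R \<Longrightarrow> Im z = 0 \<Longrightarrow> Im (\<phi> z) = 0"
    and sign: "\<And>z. z \<in> ball 0 R \<Longrightarrow> Im z \<noteq> 0 \<Longrightarrow> Im z * Im (\<phi> z) > 0"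
    and pos: "\<And>z. z \<in> ball 0 R \<Longrightarrow> deriv \<phi> z \<noteq> 0 \<Longrightarrow> Re (deriv \<psi> z / deriv \<phi> z) > 0"
  shows "inj_on (\<lambda>z. Complex (Re (\<psi> z)) (Im (\<phi> z))) (ball 0 (sqrt 6 - sqrt 5))"
proof -
  define q where "q = (\<lambda>t z. 1 - 2 * of_real t * z + z\<^sup>2 :: complex)"
  have sm: "norm z < 11/50" if "z \<in> ball 0 (sqrt 6 - sqrt 5)" for z :: complex
    using that sqrt6_minus_sqrt5_less by simp
  have q0: "q t z \<noteq> 0" if "z \<in> ball 0 (sqrt 6 - sqrt 5)" "t \<in> {-1..1}" for t z
    unfolding q_def by (rule koebe_denominator_nonzero[OF sm]) (use that in auto)
  have dq: "(q t has_field_derivative (2 * z - 2 * of_real t)) (at z)" for t z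
    unfolding q_def by (auto intro!: derivative_eq_intros)
  have cq: "continuous_on S (\<lambda>x. q (snd x) (fst x))" for S
    unfolding q_def by (intro continuous_intros)
  have q_ne: "\<forall>x\<in>ball 0 (sqrt 6 - sqrt 5) \<times> {-1..1}. q (snd x) (fst x) ^ n \<noteq> 0" for n
    using q0 by (auto simp del: mem_ball atLeastAtMost_iff)
  show ?thesis
  proof (rule typically_real_pair_inj_on[OF R hol real sign pos, where \<sigma> = "\<lambda>z. z"
        and k = "\<lambda>t z. z / q t z" and ?k1.0 = "\<lambda>t z. (1 - z\<^sup>2) / (q t z)\<^sup>2"
        and ?k2.0 = "\<lambda>t z. (- 2 * z * q t z - 2 * (1 - z\<^sup>2) * (2 * z - 2 * of_real t)) / (q t z)^3"])
    fix z assume "z \<in> ball (0::complex) (sqrt 6 - sqrt 5)"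
    thus "norm z < 1" using sm[of z] by simp
  next
    fix z assume "z \<in> ball (0::complex) (sqrt 6 - sqrt 5)" "Im z \<noteq> 0"
    thus "Im z * Im z > 0" by (metis not_real_square_gt_zero)
    from \<open>z \<in> _\<close> \<open>Im z \<noteq> 0\<close>
    show "\<exists>l. \<forall>t\<in>{-1..1}. Im z * Im (z * ((1 - z\<^sup>2) / (q t z)\<^sup>2) + z\<^sup>2 * ((- 2 * z * q t z - 2 * (1 - z\<^sup>2) * (2 * z - 2 * of_real t)) / (q t z)^3))
        + l * Re (z * ((1 - z\<^sup>2) / (q t z)\<^sup>2)) > 0"
      unfolding q_def by (intro koebe_kernel_critical) simp_all
  next
    fix t z assume tz: "t \<in> {-1..1::real}" "z \<in> ball (0::complex) (sqrt 6 - sqrt 5)"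
    note q0 = q0[OF tz(2,1)]
    show "((\<lambda>z. z / q t z) has_field_derivative (1 - z\<^sup>2) / (q t z)\<^sup>2) (at z)"
    proof -
      have "1 * q t z - z * (2 * z - 2 * of_real t) = 1 - z\<^sup>2"
        unfolding q_def by algebra
      with DERIV_divide[OF DERIV_ident dq q0] show ?thesis by (simp add: power2_eq_square)
    qed
    show "((\<lambda>z. (1 - z\<^sup>2) / (q t z)\<^sup>2) has_field_derivative
      (- 2 * z * q t z - 2 * (1 - z\<^sup>2) * (2 * z - 2 * of_real t)) / (q t z)^3) (at z)"
    proof -
      have d1: "((\<lambda>z. 1 - z\<^sup>2) has_field_derivative - 2 * z) (at z)" by (auto intro!: derivative_eq_intros)
      have d2: "((\<lambda>z. (q t z)\<^sup>2) has_field_derivative 2 * q t z * (2 * z - 2 * of_real t)) (at z)"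
        by (rule derivative_eq_intros dq refl)+ simp
      have "(- 2 * z * (q t z)\<^sup>2 - (1 - z\<^sup>2) * (2 * q t z * (2 * z - 2 * of_real t))) / ((q t z)\<^sup>2 * (q t z)\<^sup>2)
        = (- 2 * z * q t z - 2 * (1 - z\<^sup>2) * (2 * z - 2 * of_real t)) / (q t z)^3"
        using q0 by (simp add: divide_simps) algebra
      with DERIV_divide[OF d1 d2] q0 show ?thesis by simp
    qed
    show "Re ((1 - z\<^sup>2) / (q t z)\<^sup>2) > 0"
      unfolding q_def by (rule koebe_kernel_Re_deriv_pos[OF sm[OF tz(2)]]) (use tz in auto)
  next
    show "continuous_on (ball 0 (sqrt 6 - sqrt 5) \<times> {-1..1}) (\<lambda>(z, t). z / q t z)"
      unfolding case_prod_unfold by (intro continuous_intros cq) (use q_ne[of 1] in auto)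
    show "continuous_on (ball 0 (sqrt 6 - sqrt 5) \<times> {-1..1}) (\<lambda>(z, t). (1 - z\<^sup>2) / (q t z)\<^sup>2)"
      unfolding case_prod_unfold by (intro continuous_intros cq q_ne)
    show "continuous_on (ball 0 (sqrt 6 - sqrt 5) \<times> {-1..1}) (\<lambda>(z, t). (- 2 * z * q t z - 2 * (1 - z\<^sup>2) * (2 * z - 2 * of_real t)) / (q t z)^3)"
      unfolding case_prod_unfold by (intro continuous_intros cq q_ne)
  qed (auto simp: q_def)
qed

text \<open>
  The branch of the inverse of \<open>z \<mapsto> 2z/(1 + z\<^sup>2)\<close> with values in the unit disk; the other solution is
  its reciprocal.
\<close>

definition half_joukowski_inverse :: "complex \<Rightarrow> complex" where
  "half_joukowski_inverse \<zeta> = \<zeta> / (1 + csqrt (1 - \<zeta>\<^sup>2))"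

lemma one_minus_square_not_nonpos:
  fixes \<zeta> :: complex assumes "norm \<zeta> < 1" shows "1 - \<zeta>\<^sup>2 \<notin> \<real>\<^sub>\<le>\<^sub>0" "Re (csqrt (1 - \<zeta>\<^sup>2)) > 0"
proof -
  have "norm (\<zeta>\<^sup>2) < 1" using assms by (simp add: norm_power power_less_one_iff abs_square_less_1)
  hence "Re (1 - \<zeta>\<^sup>2) > 0" using complex_Re_le_cmod[of "\<zeta>\<^sup>2"] by (simp del: norm_power)
  thus *: "1 - \<zeta>\<^sup>2 \<notin> \<real>\<^sub>\<le>\<^sub>0" by (auto simp: complex_nonpos_Reals_iff)
  show "Re (csqrt (1 - \<zeta>\<^sup>2)) > 0"
    using \<open>Re (1 - \<zeta>\<^sup>2) > 0\<close> by (simp del: minus_complex.simps add: add_pos_nonneg add_nonneg_pos)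
qed

text \<open>
  With \<open>q = csqrt (1 - \<zeta>\<^sup>2)\<close> one has \<open>s\<^sup>2 = (1 - q)/(1 + q)\<close>, of modulus less than 1 because \<open>Re q > 0\<close>.
\<close>

lemma half_joukowski_inverse_solves:
  fixes \<zeta> :: complex
  assumes \<zeta>: "norm \<zeta> < 1"
  defines "s \<equiv> half_joukowski_inverse \<zeta>"
  shows "norm s < 1" "1 + s\<^sup>2 \<noteq> 0" "2 * s = \<zeta> * (1 + s\<^sup>2)"
proof -
  define q where "q = csqrt (1 - \<zeta>\<^sup>2)"
  have q: "Re q > 0" unfolding q_def by (rule one_minus_square_not_nonpos[OF \<zeta>])
  have q2: "q\<^sup>2 = 1 - \<zeta>\<^sup>2" by (simp add: q_def)
  have q1: "1 + q \<noteq> 0" using q by (auto simp: complex_eq_iff)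
  have s: "s * (1 + q) = \<zeta>" using q1 by (simp add: s_def half_joukowski_inverse_def q_def)
  have s2: "s\<^sup>2 * (1 + q) = 1 - q"
  proof -
    have "s\<^sup>2 * (1 + q) * (1 + q) = (s * (1 + q))\<^sup>2" by (simp add: power2_eq_square mult_ac)
    also have "\<dots> = 1 - q\<^sup>2" unfolding s using q2 by simp
    also have "\<dots> = (1 - q) * (1 + q)" by (simp add: power2_eq_square algebra_simps)
    finally have "s\<^sup>2 * (1 + q) * (1 + q) = (1 - q) * (1 + q)" .
    thus ?thesis using q1 by simp
  qed
  have "(norm s)\<^sup>2 * norm (1 + q) = norm (1 - q)" using arg_cong[OF s2, of norm] by (simp add: norm_mult norm_power)
  moreover have "norm (1 - q) < norm (1 + q)"
    using q by (simp add: cmod_def power2_eq_square algebra_simps)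
  ultimately have "(norm s)\<^sup>2 < 1" using q1 by (metis mult_less_cancel_right2 norm_ge_zero zero_less_norm_iff not_le order_less_le)
  thus "norm s < 1" by (simp add: abs_square_less_1)
  have "(1 + s\<^sup>2) * (1 + q) = 2" using s2 by (simp add: algebra_simps)
  thus "1 + s\<^sup>2 \<noteq> 0" by auto
  have "2 * s * (1 + q) = 2 * \<zeta>" using s by (simp add: mult.assoc)
  moreover have "\<zeta> * (1 + s\<^sup>2) * (1 + q) = \<zeta> * 2" using \<open>(1 + s\<^sup>2) * (1 + q) = 2\<close> by (simp add: mult.assoc)
  ultimately have "2 * s * (1 + q) = \<zeta> * (1 + s\<^sup>2) * (1 + q)" by (metis mult.commute)
  thus "2 * s = \<zeta> * (1 + s\<^sup>2)" using q1 by simp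
qed

lemma half_joukowski_inverse_holomorphic: "half_joukowski_inverse holomorphic_on ball 0 1"
proof -
  have "1 + csqrt (1 - z\<^sup>2) \<noteq> 0" if "z \<in> ball 0 1" for z
  proof -
    have "Re (1 + csqrt (1 - z\<^sup>2)) > 0"
      using one_minus_square_not_nonpos(2)[OF that[unfolded mem_ball_0]]
      by (simp only: plus_complex.simps one_complex.simps; linarith)
    thus ?thesis by (metis less_irrefl zero_complex.simps(1))
  qed
  thus ?thesis unfolding half_joukowski_inverse_def
    by (intro holomorphic_intros) (use one_minus_square_not_nonpos(1) in auto)
qed

lemma one_plus_square_nonzero:
  fixes z :: complex
  assumes "norm z < 1"
  shows "1 + z\<^sup>2 \<noteq> 0"
proof
  assume "1 + z\<^sup>2 = 0"
  hence "norm (z\<^sup>2) = 1" by (metis add_eq_0_iff norm_minus_cancel norm_one)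
  moreover have "norm (z\<^sup>2) < 1" using assms by (simp add: norm_power abs_square_less_1)
  ultimately show False by simp
qed

lemma half_joukowski_inverse_left_inverse:
  fixes z :: complex
  assumes z: "norm z < 1"
  shows "half_joukowski_inverse (2 * z / (1 + z\<^sup>2)) = z"
proof -
  have n: "norm (z\<^sup>2) < 1" using z by (simp add: norm_power abs_square_less_1)
  have z1: "1 + z\<^sup>2 \<noteq> 0" by (rule one_plus_square_nonzero[OF z])
  have "1 - (2 * z / (1 + z\<^sup>2))\<^sup>2 = ((1 - z\<^sup>2) / (1 + z\<^sup>2))\<^sup>2"
    using z1 by (simp add: divide_simps power_divide) algebra
  moreover have "Re ((1 - z\<^sup>2) / (1 + z\<^sup>2)) > 0"
    using Re_cayley_pos[of "- z\<^sup>2" 1] n by simp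
  ultimately have "csqrt (1 - (2 * z / (1 + z\<^sup>2))\<^sup>2) = (1 - z\<^sup>2) / (1 + z\<^sup>2)"
    by (simp add: csqrt_square)
  moreover have "1 + (1 - z\<^sup>2) / (1 + z\<^sup>2) = 2 / (1 + z\<^sup>2)" using z1 by (simp add: divide_simps)
  ultimately show ?thesis using z1 by (simp add: half_joukowski_inverse_def)
qed

text \<open>
  \<open>\<zeta> \<bar>1 + s\<^sup>2\<bar>\<^sup>2 = 2 s (1 + cnj s\<^sup>2)\<close> has imaginary part \<open>2 Im s (1 - \<bar>s\<bar>\<^sup>2)\<close>.
\<close>

lemma half_joukowski_Im:
  fixes s \<zeta> :: complex
  assumes s: "norm s < 1" and eq: "2 * s = \<zeta> * (1 + s\<^sup>2)"
  shows "Im \<zeta> = 0 \<Longrightarrow> Im s = 0" "Im \<zeta> \<noteq> 0 \<Longrightarrow> Im \<zeta> * Im s > 0"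
proof -
  have s1: "1 + s\<^sup>2 \<noteq> 0" by (rule one_plus_square_nonzero[OF s])
  have "\<zeta> * (1 + s\<^sup>2) * cnj (1 + s\<^sup>2) = 2 * s * cnj (1 + s\<^sup>2)" using eq by simp
  hence "\<zeta> * of_real ((norm (1 + s\<^sup>2))\<^sup>2) = 2 * s * cnj (1 + s\<^sup>2)"
    by (simp only: mult.assoc complex_norm_square)
  moreover have "Im (\<zeta> * of_real N) = Im \<zeta> * N" for N by simp
  ultimately have "Im \<zeta> * (norm (1 + s\<^sup>2))\<^sup>2 = Im (2 * s * cnj (1 + s\<^sup>2))" by metis
  also have "\<dots> = 2 * Im s * (1 - (norm s)\<^sup>2)"
    by (simp add: cmod_power2 Re_power2 Im_power2 del: complex_cnj_power; algebra)
  finally have *: "Im \<zeta> * (norm (1 + s\<^sup>2))\<^sup>2 = 2 * Im s * (1 - (norm s)\<^sup>2)" .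
  have p: "(norm (1 + s\<^sup>2))\<^sup>2 > 0" "1 - (norm s)\<^sup>2 > 0" using s s1 by (auto simp: abs_square_less_1)
  show "Im s = 0" if "Im \<zeta> = 0" using * p that by auto
  show "Im \<zeta> * Im s > 0" if "Im \<zeta> \<noteq> 0"
  proof -
    have "Im \<zeta> * (Im \<zeta> * (norm (1 + s\<^sup>2))\<^sup>2) > 0"
      using that p by (metis mult.assoc mult_pos_pos not_real_square_gt_zero)
    hence "2 * (1 - (norm s)\<^sup>2) * (Im \<zeta> * Im s) > 0" unfolding * by (simp add: mult_ac)
    thus ?thesis using p by (simp add: zero_less_mult_iff)
  qed
qed

lemma typically_real_pair_inj_on_joukowski_disc:
  fixes \<phi> \<psi> :: "complex \<Rightarrow> complex"
  assumes R: "R > 1" and hol: "\<phi> holomorphic_on ball 0 R" "\<psi> holomorphic_on ball 0 R"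
    and real: "\<And>z. z \<in> ball 0 R \<Longrightarrow> Im z = 0 \<Longrightarrow> Im (\<phi> z) = 0"
    and sign: "\<And>z. z \<in> ball 0 R \<Longrightarrow> Im z \<noteq> 0 \<Longrightarrow> Im z * Im (\<phi> z) > 0"
    and pos: "\<And>z. z \<in> ball 0 R \<Longrightarrow> deriv \<phi> z \<noteq> 0 \<Longrightarrow> Re (deriv \<psi> z / deriv \<phi> z) > 0"
  shows "inj_on (\<lambda>z. Complex (Re (\<psi> z)) (Im (\<phi> z))) {z \<in> ball 0 1. norm (2 * z / (1 + z\<^sup>2)) < sqrt 2 - 1}"
proof -
  define s where "s = half_joukowski_inverse"
  have "sqrt 2 < 3/2" by (rule real_less_lsqrt) (auto simp: power2_eq_square)
  hence r2: "sqrt 2 - 1 < (1/2::real)" by simp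
  have sm: "norm z < 1/2" if "z \<in> ball 0 (sqrt 2 - 1)" for z :: complex
    using that r2 by simp
  have ts: "norm (of_real t * z) < 1/2" if "z \<in> ball 0 (sqrt 2 - 1)" "t \<in> {-1..1}" for t and z :: complex
  proof -
    have "norm (of_real t * z) \<le> norm z" using that(2) by (simp add: norm_mult mult_left_le_one_le abs_le_iff)
    thus ?thesis using sm[OF that(1)] by linarith
  qed
  have q0: "1 - of_real t * z \<noteq> 0" if "z \<in> ball 0 (sqrt 2 - 1)" "t \<in> {-1..1}" for t and z :: complex
    using ts[OF that] by auto
  have q_ne: "\<forall>x\<in>ball (0::complex) (sqrt 2 - 1) \<times> {-1..1}. (1 - of_real (snd x) * fst x) ^ n \<noteq> 0" for n
    using q0 by (auto simp del: mem_ball atLeastAtMost_iff)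
  have sp: "norm (s z) < 1" "1 + (s z)\<^sup>2 \<noteq> 0" "2 * s z = z * (1 + (s z)\<^sup>2)" if "z \<in> ball 0 (sqrt 2 - 1)" for z
    using half_joukowski_inverse_solves[of z] sm[OF that] unfolding s_def by simp_all
  have "inj_on (\<lambda>z. Complex (Re (\<psi> (s z))) (Im (\<phi> (s z)))) (ball 0 (sqrt 2 - 1))"
  proof (rule typically_real_pair_inj_on[OF R hol real sign pos, where \<sigma> = s
        and k = "\<lambda>t z. z / (2 * (1 - of_real t * z))" and ?k1.0 = "\<lambda>t z. 1 / (2 * (1 - of_real t * z)\<^sup>2)"
        and ?k2.0 = "\<lambda>t z. of_real t / (1 - of_real t * z)^3"])
    show "s holomorphic_on ball 0 (sqrt 2 - 1)"
      unfolding s_def by (rule holomorphic_on_subset[OF half_joukowski_inverse_holomorphic]) (use r2 in auto)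
  next
    fix t z assume tz: "t \<in> {-1..1::real}" "z \<in> ball (0::complex) (sqrt 2 - 1)"
    note q0 = q0[OF tz(2,1)]
    note s = sp[OF tz(2)]
    define U where "U = 1 + (s z)\<^sup>2"
    have U: "U \<noteq> 0" "s z = z * U / 2"
    proof -
      have "s z = 2 * s z / 2" by simp
      thus "s z = z * U / 2" unfolding s(3) U_def .
    qed (use s(2) U_def in simp)
    have den: "1 - 2 * of_real t * s z + (s z)\<^sup>2 = U * (1 - of_real t * z)"
    proof -
      have "1 - 2 * of_real t * s z + (s z)\<^sup>2 = U - of_real t * (2 * s z)" by (simp add: U_def algebra_simps)
      also have "\<dots> = U - of_real t * (z * U)" unfolding s(3) U_def ..
      finally show ?thesis by (simp add: algebra_simps)
    qed
    have "s z / (U * (1 - of_real t * z)) = z * U / 2 / (U * (1 - of_real t * z))"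
      by (rule arg_cong[OF U(2)])
    also have "\<dots> = z / (2 * (1 - of_real t * z))" using U(1) q0 by simp
    finally show "s z / (1 - 2 * of_real t * s z + (s z)\<^sup>2) = z / (2 * (1 - of_real t * z))"
      unfolding den .
    show "((\<lambda>z. z / (2 * (1 - of_real t * z))) has_field_derivative 1 / (2 * (1 - of_real t * z)\<^sup>2)) (at z)"
    proof -
      have d: "((\<lambda>z. 2 * (1 - of_real t * z)) has_field_derivative - (2 * of_real t)) (at z)"
        by (auto intro!: derivative_eq_intros)
      have "(1 * (2 * v) - z * (- (2 * c))) / ((2 * v) * (2 * v)) = 1 / (2 * v\<^sup>2)"
        if "v \<noteq> 0" "v = 1 - c * z" for v c :: complex
      proof -
        have "1 * (2 * v) - z * (- (2 * c)) = 2" unfolding that(2) by (simp add: algebra_simps)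
        thus ?thesis using that(1) by (simp add: power2_eq_square)
      qed
      with DERIV_divide[OF DERIV_ident d] q0 show ?thesis by simp
    qed
    show "((\<lambda>z. 1 / (2 * (1 - of_real t * z)\<^sup>2)) has_field_derivative of_real t / (1 - of_real t * z)^3) (at z)"
    proof -
      have d: "((\<lambda>z. 2 * (1 - of_real t * z)\<^sup>2) has_field_derivative - (4 * of_real t * (1 - of_real t * z))) (at z)"
        by (auto intro!: derivative_eq_intros)
      have "(0 * (2 * (1 - of_real t * z)\<^sup>2) - 1 * (- (4 * of_real t * (1 - of_real t * z)))) / ((2 * (1 - of_real t * z)\<^sup>2) * (2 * (1 - of_real t * z)\<^sup>2)) = of_real t / (1 - of_real t * z)^3"
      proof -
        have "(0 * (2 * v\<^sup>2) - 1 * (- (4 * c * v))) / ((2 * v\<^sup>2) * (2 * v\<^sup>2)) = c / v^3" if "v \<noteq> 0" for v c :: complex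
          using that by (simp add: divide_simps power2_eq_square power3_eq_cube)
        from this[OF q0] show ?thesis .
      qed
      with DERIV_divide[OF DERIV_const[of "1::complex"] d] q0 show ?thesis by simp
    qed
    show "Re (1 / (2 * (1 - of_real t * z)\<^sup>2)) > 0"
    proof -
      define p where "p = of_real t * z"
      have "norm p < 1/2" unfolding p_def by (rule ts[OF tz(2,1)])
      hence "\<bar>Re p\<bar> < 1/2" "\<bar>Im p\<bar> < 1/2" using abs_Re_le_cmod[of p] abs_Im_le_cmod[of p] by linarith+
      hence "\<bar>Im p\<bar> < 1 - Re p" by linarith
      hence "(Im p)\<^sup>2 < (1 - Re p)\<^sup>2" by (metis abs_ge_zero power2_abs power_strict_mono pos2)
      hence "Re (2 * (1 - p)\<^sup>2) > 0" by (simp add: Re_power2)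
      moreover have "Re (1 / w) > 0" if "Re w > 0" for w
        using that by (auto simp: Re_divide sum_power2_gt_zero_iff)
      ultimately show ?thesis unfolding p_def[symmetric] by blast
    qed
  next
    fix z assume z: "z \<in> ball (0::complex) (sqrt 2 - 1)"
    show "norm (s z) < 1" by (rule sp[OF z])
    show "Im (s z) = 0" if "Im z = 0" by (rule half_joukowski_Im(1)[OF sp(1,3)[OF z] that])
    show "Im z * Im (s z) > 0" if "Im z \<noteq> 0" by (rule half_joukowski_Im(2)[OF sp(1,3)[OF z] that])
    show "\<exists>l. \<forall>t\<in>{-1..1}. Im z * Im (z * (1 / (2 * (1 - of_real t * z)\<^sup>2)) + z\<^sup>2 * (of_real t / (1 - of_real t * z)^3))
        + l * Re (z * (1 / (2 * (1 - of_real t * z)\<^sup>2))) > 0" if "Im z \<noteq> 0"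
      by (rule geometric_kernel_critical) (use z that in auto)
  next
    show "continuous_on (ball 0 (sqrt 2 - 1) \<times> {-1..1}) (\<lambda>(z, t). z / (2 * (1 - of_real t * z)) :: complex)"
      unfolding case_prod_unfold by (intro continuous_intros) (use q_ne[of 1] in auto)
    show "continuous_on (ball 0 (sqrt 2 - 1) \<times> {-1..1}) (\<lambda>(z, t). 1 / (2 * (1 - of_real t * z)\<^sup>2) :: complex)"
      unfolding case_prod_unfold by (intro continuous_intros) (use q_ne[of 2] in auto)
    show "continuous_on (ball 0 (sqrt 2 - 1) \<times> {-1..1}) (\<lambda>(z, t). of_real t / (1 - of_real t * z)^3 :: complex)"
      unfolding case_prod_unfold by (intro continuous_intros q_ne)
  qed
  note inj = inj_onD[OF this]
  show ?thesis
  proof (rule inj_onI)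
    fix a b assume ab: "a \<in> {z \<in> ball 0 1. norm (2 * z / (1 + z\<^sup>2)) < sqrt 2 - 1}" "b \<in> {z \<in> ball 0 1. norm (2 * z / (1 + z\<^sup>2)) < sqrt 2 - 1}"
      "Complex (Re (\<psi> a)) (Im (\<phi> a)) = Complex (Re (\<psi> b)) (Im (\<phi> b))"
    have s: "s (2 * a / (1 + a\<^sup>2)) = a" "s (2 * b / (1 + b\<^sup>2)) = b"
      using ab half_joukowski_inverse_left_inverse unfolding s_def by auto
    have "2 * a / (1 + a\<^sup>2) = 2 * b / (1 + b\<^sup>2)"
      by (rule inj) (use ab s in simp_all)
    thus "a = b" using s by metis
  qed
qed

section \<open>Sense-preserving harmonic functions\<close>

text \<open>
  If \<open>h' z \<noteq> 0\<close>, this is \<open>\<bar>\<omega> z\<bar> < 1\<close>.  If \<open>h' z = 0\<close>, the zero is isolated, so \<open>\<bar>g'\<bar> \<le> \<bar>h'\<bar>\<close> around \<open>z\<close>,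
  hence at \<open>z\<close>, and \<open>g' z = 0 = h' z\<close> is excluded by \<open>ne\<close>.
\<close>

lemma sense_preserving_at_imp_norm_deriv_less:
  assumes h: "h holomorphic_on S" and g: "g holomorphic_on S" and S: "open S" "z \<in> S"
    and sp: "sense_preserving_at h g z" and ne: "deriv h z \<noteq> deriv g z"
  shows "norm (deriv g z) < norm (deriv h z)"
proof -
  define F where "F = (\<lambda>z. deriv g z / deriv h z)"
  define \<omega> where "\<omega> = dilatation h g"
  have h': "deriv h holomorphic_on S" and g': "deriv g holomorphic_on S" using h g S by (auto intro: holomorphic_deriv)
  have \<omega>: "\<omega> analytic_on {z}" "norm (\<omega> z) < 1" and nz: "\<not> (\<forall>\<^sub>F w in nhds z. deriv h w = 0)"
    using sp by (auto simp: sense_preserving_at_def \<omega>_def)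
  have \<omega>F: "\<omega> w = F w" if "w \<in> S" "deriv h w \<noteq> 0" for w
  proof -
    have "deriv g analytic_on {w}" "deriv h analytic_on {w}"
      using h' g' S that by (auto simp: analytic_on_open intro: analytic_on_subset[of _ S])
    hence "F analytic_on {w}" unfolding F_def by (rule analytic_on_divide) (use that in auto)
    thus ?thesis unfolding \<omega>_def dilatation_def F_def by simp
  qed
  show ?thesis
  proof (cases "deriv h z = 0")
    case False
    from \<omega>(2) \<omega>F[OF S(2) False] False show ?thesis by (simp add: F_def norm_divide divide_simps)
  next
    case True
    obtain e where e: "e > 0" "ball z e \<subseteq> S" using S openE by blast
    have "\<exists>b\<in>ball z e. deriv h b \<noteq> 0"
    proof (rule ccontr)
      assume "\<not> ?thesis"
      hence "\<forall>\<^sub>F w in nhds z. deriv h w = 0"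
        using e(1) eventually_nhds_in_open[of "ball z e" z] by (auto elim!: eventually_mono)
      thus False using nz by simp
    qed
    then obtain b where b: "b \<in> ball z e" "deriv h b \<noteq> 0" by blast
    have ev1: "\<forall>\<^sub>F w in at z. deriv h w \<noteq> 0 \<and> w \<in> ball z e"
      by (rule non_zero_neighbour_alt[OF holomorphic_on_subset[OF h' e(2)] _ _ _ b]) (use e in auto)
    have "isCont \<omega> z" using \<omega>(1) analytic_at_imp_isCont by blast
    hence "((\<lambda>w. norm (\<omega> w)) \<longlongrightarrow> norm (\<omega> z)) (at z)" by (intro tendsto_norm) (simp add: isCont_def)
    hence ev2: "\<forall>\<^sub>F w in at z. norm (\<omega> w) < 1" using \<omega>(2) order_tendstoD(2) by blast
    have "\<forall>\<^sub>F w in at z. norm (deriv g w) \<le> norm (deriv h w)"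
      using ev1 ev2
    proof eventually_elim
      case (elim w)
      have "\<omega> w = F w" using \<omega>F elim e by blast
      hence "norm (deriv g w) = norm (\<omega> w) * norm (deriv h w)" using elim by (simp add: F_def norm_divide)
      thus ?case using elim by (simp add: mult_left_le_one_le)
    qed
    moreover have "((\<lambda>w. norm (deriv g w)) \<longlongrightarrow> norm (deriv g z)) (at z)" "((\<lambda>w. norm (deriv h w)) \<longlongrightarrow> norm (deriv h z)) (at z)"
      using h' g' S by (auto intro!: tendsto_norm simp: isCont_def[symmetric] continuous_on_eq_continuous_at dest!: holomorphic_on_imp_continuous_on)
    ultimately have "norm (deriv g z) \<le> norm (deriv h z)" by (intro tendsto_le[of "at z"]) auto
    with True ne show ?thesis by auto
  qed
qed

text \<open>
  \<open>Im \<phi>\<close> has no zero in the connected upper half disk, and conjugation carries its sign to the lower one.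
\<close>

lemma real_iff_imp_constant_sign:
  fixes \<phi> :: "complex \<Rightarrow> complex"
  assumes hol: "\<phi> holomorphic_on ball 0 R"
    and real: "\<And>z. z \<in> ball 0 R \<Longrightarrow> Im (\<phi> z) = 0 \<longleftrightarrow> Im z = 0"
  shows "\<exists>c\<in>{1,-1::real}. \<forall>z\<in>ball 0 R. Im z \<noteq> 0 \<longrightarrow> Im z * (c * Im (\<phi> z)) > 0"
proof -
  define H where "H = ball (0::complex) R \<inter> {z. Im z > 0}"
  have "convex H" unfolding H_def by (intro convex_Int convex_ball convex_halfspace_Im_gt)
  moreover have "continuous_on H (\<lambda>z. Im (\<phi> z))"
    by (intro continuous_intros continuous_on_subset[OF holomorphic_on_imp_continuous_on[OF hol]]) (auto simp: H_def)
  ultimately have con: "connected ((\<lambda>z. Im (\<phi> z)) ` H)" using connected_continuous_image convex_connected by blast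
  have no0: "0 \<notin> (\<lambda>z. Im (\<phi> z)) ` H" using real by (auto simp: H_def)
  have "\<exists>c\<in>{1,-1::real}. \<forall>z\<in>H. c * Im (\<phi> z) > 0"
  proof (rule ccontr)
    assume "\<not> ?thesis"
    then obtain a b where ab: "a \<in> H" "b \<in> H" "Im (\<phi> a) \<le> 0" "Im (\<phi> b) \<ge> 0" by (auto simp: not_less)
    have "0 \<in> (\<lambda>z. Im (\<phi> z)) ` H"
      using connectedD_interval[OF con, of "Im (\<phi> a)" "Im (\<phi> b)" 0] ab by blast
    thus False using no0 by contradiction
  qed
  then obtain c where c: "c \<in> {1,-1}" "\<And>z. z \<in> H \<Longrightarrow> c * Im (\<phi> z) > 0" by blast
  have "Im z * (c * Im (\<phi> z)) > 0" if z: "z \<in> ball 0 R" "Im z \<noteq> 0" for z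
  proof (cases "Im z > 0")
    case True
    thus ?thesis using c(2)[of z] z by (simp add: H_def)
  next
    case False
    hence neg: "Im z < 0" using z by simp
    have "cnj z \<in> H" using z neg by (simp add: H_def)
    from c(2)[OF this] have "c * Im (\<phi> z) < 0" using holomorphic_cnj_commute[OF hol _ z(1)] real by simp
    thus ?thesis using neg by (rule mult_neg_neg[rotated])
  qed
  thus ?thesis using c(1) by blast
qed

theorem theorem6:
  fixes f :: "complex \<Rightarrow> complex"
  assumes "f \<in> T_H_O"
  shows "inj_on f (ball 0 (sqrt 6 - sqrt 5)) \<and>
         inj_on f {z \<in> ball 0 1. norm (2 * z / (1 + z\<^sup>2)) < sqrt 2 - 1}"
proof -
  obtain h g where rep: "T_H_repr f h g" using assms by (auto simp: T_H_O_def)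
  have hol: "h holomorphic_on ball 0 1" "g holomorphic_on ball 0 1"
    and f_eq: "\<And>z. z \<in> ball 0 1 \<Longrightarrow> f z = h z + cnj (g z)"
    and sp: "\<And>z. z \<in> ball 0 1 \<Longrightarrow> sense_preserving_at h g z"
    and f_real: "\<And>z. z \<in> ball 0 1 \<Longrightarrow> f z \<in> \<real> \<longleftrightarrow> z \<in> \<real>"
    using rep by (auto simp: T_H_repr_def canonical_repr_def)
  have hol_diff: "(\<lambda>z. h z - g z) holomorphic_on ball 0 1" by (intro holomorphic_intros hol)
  have Im_diff: "Im (h z - g z) = 0 \<longleftrightarrow> Im z = 0" if "z \<in> ball 0 1" for z
    using f_real[OF that] f_eq[OF that] by (simp add: complex_is_Real_iff)
  \<comment> \<open>The sign \<open>c\<close> makes \<open>c(h - g)\<close> typically real; \<open>f\<close> and \<open>cf\<close> are injective on the same sets.\<close>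
  obtain c where c: "c \<in> {1,-1::real}" "\<And>z. z \<in> ball 0 1 \<Longrightarrow> Im z \<noteq> 0 \<Longrightarrow> Im z * (c * Im (h z - g z)) > 0"
    using real_iff_imp_constant_sign[OF hol_diff Im_diff] by blast
  have c0: "c \<noteq> 0" using c(1) by auto
  define \<phi> where "\<phi> = (\<lambda>\<rho> z. of_real c * (h (of_real \<rho> * z) - g (of_real \<rho> * z)))"
  define \<psi> where "\<psi> = (\<lambda>\<rho> z. of_real c * (h (of_real \<rho> * z) + g (of_real \<rho> * z)))"
  have f\<rho>: "Complex (Re (\<psi> \<rho> z)) (Im (\<phi> \<rho> z)) = of_real c * f (of_real \<rho> * z)" if "of_real \<rho> * z \<in> ball 0 1" for \<rho> z
    using f_eq[OF that] by (simp add: \<phi>_def \<psi>_def complex_eq_iff)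
  have *: "inj_on (\<lambda>z. Complex (Re (\<psi> \<rho> z)) (Im (\<phi> \<rho> z))) (ball 0 (sqrt 6 - sqrt 5))"
       "inj_on (\<lambda>z. Complex (Re (\<psi> \<rho> z)) (Im (\<phi> \<rho> z))) {z \<in> ball 0 1. norm (2 * z / (1 + z\<^sup>2)) < sqrt 2 - 1}"
    if \<rho>: "0 < \<rho>" "\<rho> < 1" for \<rho>
  proof -
    have R: "1 / \<rho> > 1" using \<rho> by simp
    have inB: "of_real \<rho> * z \<in> ball 0 1" if "z \<in> ball 0 (1 / \<rho>)" for z :: complex
      using that \<rho> by (simp add: norm_mult field_simps)
    have scale: "(\<lambda>z. k (of_real \<rho> * z)) holomorphic_on ball 0 (1 / \<rho>)" if "k holomorphic_on ball 0 1" for k :: "complex \<Rightarrow> complex"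
    proof -
      have "(\<lambda>z. of_real \<rho> * z) ` ball 0 (1 / \<rho>) \<subseteq> ball (0::complex) 1" using inB by blast
      from holomorphic_on_compose_gen[OF _ that this] show ?thesis
        by (auto simp: o_def intro!: holomorphic_intros)
    qed
    have hol': "\<phi> \<rho> holomorphic_on ball 0 (1 / \<rho>)" "\<psi> \<rho> holomorphic_on ball 0 (1 / \<rho>)"
      unfolding \<phi>_def \<psi>_def by (intro holomorphic_intros scale hol)+
    have real': "Im (\<phi> \<rho> z) = 0" if "z \<in> ball 0 (1 / \<rho>)" "Im z = 0" for z
      using Im_diff[OF inB[OF that(1)]] that by (simp add: \<phi>_def)
    have sign': "Im z * Im (\<phi> \<rho> z) > 0" if "z \<in> ball 0 (1 / \<rho>)" "Im z \<noteq> 0" for z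
    proof -
      have "\<rho> * (Im z * Im (\<phi> \<rho> z)) > 0"
        using c(2)[OF inB[OF that(1)]] that \<rho> by (simp add: \<phi>_def mult_ac)
      thus ?thesis using \<rho> by (simp add: zero_less_mult_iff)
    qed
    have pos': "Re (deriv (\<psi> \<rho>) z / deriv (\<phi> \<rho>) z) > 0" if z: "z \<in> ball 0 (1 / \<rho>)" and ne: "deriv (\<phi> \<rho>) z \<noteq> 0" for z
    proof -
      define w where "w = of_real \<rho> * z"
      have w: "w \<in> ball 0 1" unfolding w_def by (rule inB[OF z])
      have dk: "((\<lambda>z. k (of_real \<rho> * z)) has_field_derivative deriv k w * of_real \<rho>) (at z)"
        if "k holomorphic_on ball 0 1" for k :: "complex \<Rightarrow> complex"
      proof -
        have "(k has_field_derivative deriv k w) (at (of_real \<rho> * z))"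
          using holomorphic_derivI[OF that open_ball w] unfolding w_def .
        moreover have "((\<lambda>z. of_real \<rho> * z) has_field_derivative of_real \<rho>) (at z)"
          by (auto intro!: derivative_eq_intros)
        ultimately show ?thesis by (rule DERIV_chain2)
      qed
      have d: "deriv (\<phi> \<rho>) z = of_real (c * \<rho>) * (deriv h w - deriv g w)"
          "deriv (\<psi> \<rho>) z = of_real (c * \<rho>) * (deriv h w + deriv g w)"
        unfolding \<phi>_def \<psi>_def
        by (rule DERIV_imp_deriv, (rule derivative_eq_intros dk hol refl)+, simp add: algebra_simps)+
      have "norm (deriv g w) < norm (deriv h w)"
        by (rule sense_preserving_at_imp_norm_deriv_less[OF hol open_ball w sp[OF w]]) (use ne d in auto)
      from Re_cayley_pos[OF this] show ?thesis unfolding d using c0 \<rho> by simp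
    qed
    show "inj_on (\<lambda>z. Complex (Re (\<psi> \<rho> z)) (Im (\<phi> \<rho> z))) (ball 0 (sqrt 6 - sqrt 5))"
      by (rule typically_real_pair_inj_on_disc[OF R hol' real' sign' pos'])
    show "inj_on (\<lambda>z. Complex (Re (\<psi> \<rho> z)) (Im (\<phi> \<rho> z))) {z \<in> ball 0 1. norm (2 * z / (1 + z\<^sup>2)) < sqrt 2 - 1}"
      by (rule typically_real_pair_inj_on_joukowski_disc[OF R hol' real' sign' pos'])
  qed
  \<comment> \<open>Two points with equal values are separated by \<open>z \<mapsto> f (\<rho>z)\<close> once both, divided by \<open>\<rho>\<close>, lie in \<open>U\<close>.\<close>
  have exhaust: "inj_on f U"
    if U: "open U" "U \<subseteq> ball 0 1" and inj: "\<And>\<rho>. 0 < \<rho> \<Longrightarrow> \<rho> < 1 \<Longrightarrow> inj_on (\<lambda>z. Complex (Re (\<psi> \<rho> z)) (Im (\<phi> \<rho> z))) U" for U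
  proof (rule inj_onI)
    fix a b assume ab: "a \<in> U" "b \<in> U" "f a = f b"
    have ev: "\<forall>\<^sub>F \<rho> in at_left (1::real). z / of_real \<rho> \<in> U" if "z \<in> U" for z
    proof -
      have "((\<lambda>\<rho>::real. z / of_real \<rho>) \<longlongrightarrow> z / of_real 1) (at_left 1)" by (intro tendsto_intros) auto
      thus ?thesis using topological_tendstoD[OF _ U(1)] that by fastforce
    qed
    have "\<forall>\<^sub>F \<rho> in at_left (1::real). \<rho> \<in> {0<..<1}" by (rule eventually_at_leftI[of 0]) auto
    with ev[OF ab(1)] ev[OF ab(2)] have "\<forall>\<^sub>F \<rho> in at_left (1::real). 0 < \<rho> \<and> \<rho> < 1 \<and> a / of_real \<rho> \<in> U \<and> b / of_real \<rho> \<in> U"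
      by eventually_elim auto
    then obtain \<rho> where \<rho>: "0 < \<rho>" "\<rho> < 1" "a / of_real \<rho> \<in> U" "b / of_real \<rho> \<in> U"
      using eventually_happens'[OF trivial_limit_at_left_real] by blast
    have val: "Complex (Re (\<psi> \<rho> (z / of_real \<rho>))) (Im (\<phi> \<rho> (z / of_real \<rho>))) = of_real c * f z" if "z \<in> U" for z
    proof -
      have "of_real \<rho> * (z / of_real \<rho>) = z" using \<rho> by auto
      thus ?thesis using f\<rho>[of \<rho> "z / of_real \<rho>"] that U(2) by (metis subsetD)
    qed
    have "a / of_real \<rho> = b / of_real \<rho>"
      by (rule inj_onD[OF inj[OF \<rho>(1,2)] _ \<rho>(3,4)]) (simp only: val[OF ab(1)] val[OF ab(2)] ab(3))
    thus "a = b" using \<rho> by simp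
  qed
  have o: "open {z \<in> ball (0::complex) 1. norm (2 * z / (1 + z\<^sup>2)) < sqrt 2 - (1::real)}"
  proof -
    have nz: "1 + z\<^sup>2 \<noteq> 0" if "z \<in> ball 0 1" for z :: complex
      using that by (intro one_plus_square_nonzero) simp
    have cont: "continuous_on (ball 0 1) (\<lambda>z::complex. norm (2 * z / (1 + z\<^sup>2)))"
      by (intro continuous_intros ballI nz)
    have "open (ball 0 1 \<inter> (\<lambda>z::complex. norm (2 * z / (1 + z\<^sup>2))) -` {..<sqrt 2 - 1})"
      by (rule continuous_open_preimage[OF cont]) auto
    also have "ball 0 1 \<inter> (\<lambda>z::complex. norm (2 * z / (1 + z\<^sup>2))) -` {..<sqrt 2 - 1} = {z \<in> ball 0 1. norm (2 * z / (1 + z\<^sup>2)) < sqrt 2 - 1}"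
      by auto
    finally show ?thesis .
  qed
  have "inj_on f (ball 0 (sqrt 6 - sqrt 5))"
    by (rule exhaust) (use *(1) sqrt6_minus_sqrt5_less in auto)
  moreover have "inj_on f {z \<in> ball 0 1. norm (2 * z / (1 + z\<^sup>2)) < sqrt 2 - 1}"
    by (rule exhaust[OF o]) (use *(2) in auto)
  ultimately show ?thesis by blast
qed

end
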